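(* Let $\dim V=(n|m)$ and $h\ge 0$ an integer. The element $$\sum_{L}(-1)^{\alpha(L,L)+p(L)}\,e_s\big(v^*_{I_h}\otimes v^*_L\big)\otimes\tilde e_t\big(v_L\otimes v_{J_h}\big)\in V^{*\otimes (m+h)n}\otimes V^{\otimes(n+h)m}=\hat T^{(m+h)n,(n+h)m}(V),$$ where $L$ runs over all sequences of length $nm$ with entries in $R_V$, is $\mathfrak{sl}(V)$-invariant. (This element is $e_s\times\tilde e_t(v^*_{I_h}\otimes\hat\theta_{nm}\otimes v_{J_h})$, with $\hat\theta_{nm}=\sum_L(-1)^{\alpha(L,L)+p(L)}v^*_L\otimes v_L$.)
   Context: $V$ has homogeneous basis $e_i$, $i\in R_V=\{1,\dots,n,\bar1,\dots,\bar m\}$ (barred indices odd), $e_i^*$ the left dual basis. For a sequence $I$, $v_I=e_{i_1}\otimes\dots\otimes e_{i_N}$, $v^*_I=e^*_{i_1}\otimes\dots\otimes e^*_{i_N}$; $p(L)=\sum p(l_i)$, $\alpha(L,L)=\sum_{i<j}p(l_i)p(l_j)$. $\mathfrak S_N$ acts on $X^{\otimes N}$ ($X=V$ or $V^*$) by $\sigma v_I=c(I,\sigma^{-1})v_{\sigma I}$, where $\mathfrak S_N$ permutes positions of sequences and $c(I,\sigma)=\pm1$ is defined by $x_{\sigma^{-1}I}=c(I,\sigma)x_I$ in the free supercommutative algebra on generators $x_i$ of parity $p(i)$. For a tableau $t$ with row/column stabilizers $R_t,C_t$: $e_t=\sum_{\tau\in C_t,\sigma\in R_t}\varepsilon(\tau)\sigma\tau$,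 $\tilde e_t=\sum_{\tau\in C_t,\sigma\in R_t}\varepsilon(\tau)\tau\sigma$. $t$: tableau of rectangular shape with $n+h$ rows and $m$ columns; its first $n$ rows form $t_1$, filled with $1,\dots,nm$ consecutively column by column, its last $h$ rows form $t_2$, filled with $nm+1,\dots,nm+hm$ consecutively column by column. $s$: tableau with $n$ rows and $h+m$ columns; its first $h$ columns $s_1$ are filled with $1,\dots,hn$ consecutively column by column, its last $m$ columns $s_2$ with $hn+1,\dots,hn+mn$ consecutively column by column. $I_h$: the sequence $1,2,\dots,n$ repeated $h$ times; $J_h$: $h$ copies of $\bar1$, then $h$ copies of $\bar 2$, ..., then $h$ copies of $\bar m$. $e_s$ acts on the $V^*$-factors, $\tilde e_t$ on the $V$-factors. *)

theory Defs
  imports "HOL-Combinatorics.Permutations"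
begin

text \<open>
Conventions. dim V = (n|m). The index set R_V = {1,...,n,bar 1,...,bar m} is encoded as
{0..<n+m}: index i < n stands for i+1 (even), index n+j stands for bar(j+1) (odd).
Vectors in a tensor power X^{\<otimes>N} (X = V or V^*) are coefficient functions
nat list \<Rightarrow> 'a with respect to the basis v_I (resp. v^*_I), I a sequence of length N
with entries in R_V; elements of V^{*\<otimes>A} \<otimes> V^{\<otimes>B} are coefficient functions
nat list \<Rightarrow> nat list \<Rightarrow> 'a, W I K being the coefficient of v^*_I \<otimes> v_K.
Positions of sequences / entries of tableaux are 0-based.
\<close>

definition par :: "nat \<Rightarrow> nat \<Rightarrow> nat" where
  "par n i = (if i < n then 0 else 1)"

definition parL :: "nat \<Rightarrow> nat list \<Rightarrow> nat" where
  "parL n L = (\<Sum>i<length L. par n (L ! i))"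

definition alphaL :: "nat \<Rightarrow> nat list \<Rightarrow> nat" where
  "alphaL n L = (\<Sum>i<length L. \<Sum>j<length L. if i < j then par n (L ! i) * par n (L ! j) else 0)"

definition seqs :: "nat \<Rightarrow> nat \<Rightarrow> nat list set" where
  "seqs d N = {L. length L = N \<and> set L \<subseteq> {..<d}}"

definition basis_vec :: "nat list \<Rightarrow> nat list \<Rightarrow> 'a::field" where
  "basis_vec I = (\<lambda>J. if J = I then 1 else 0)"

text \<open>Permuting positions: (\<sigma> I)_k = I_{\<sigma>^{-1}(k)}.\<close>
definition seq_act :: "(nat \<Rightarrow> nat) \<Rightarrow> nat list \<Rightarrow> nat list" where
  "seq_act \<sigma> I = map (\<lambda>k. I ! (inv \<sigma> k)) [0..<length I]"

text \<open>The Koszul sign c(I,\<sigma>), defined by x_{\<sigma>^{-1} I} = c(I,\<sigma>) x_I in the free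
supercommutative algebra: the factor at position k of x_{\<sigma>^{-1} I} is x_{I_{\<sigma>(k)}},
and reordering produces one sign -1 for each inverted pair of odd generators.\<close>
definition csign :: "nat \<Rightarrow> nat list \<Rightarrow> (nat \<Rightarrow> nat) \<Rightarrow> 'a::field" where
  "csign n I \<sigma> = (-1) ^ card {(k, l). k < l \<and> l < length I \<and> \<sigma> l < \<sigma> k
                       \<and> par n (I ! \<sigma> k) = 1 \<and> par n (I ! \<sigma> l) = 1}"

text \<open>Action of \<sigma> on X^{\<otimes>N}: \<sigma> v_I = c(I,\<sigma>^{-1}) v_{\<sigma> I}, extended linearly.\<close>
definition perm_act :: "nat \<Rightarrow> (nat \<Rightarrow> nat) \<Rightarrow> (nat list \<Rightarrow> 'a::field) \<Rightarrow> nat list \<Rightarrow> 'a" where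
  "perm_act n \<sigma> f = (\<lambda>K. csign n (seq_act (inv \<sigma>) K) (inv \<sigma>) * f (seq_act (inv \<sigma>) K))"

text \<open>A tableau with N boxes filled with 1..N is given by the map sending the entry
k+1 (k < N) to its cell (row, column).\<close>
definition row_stab :: "nat \<Rightarrow> (nat \<Rightarrow> nat \<times> nat) \<Rightarrow> (nat \<Rightarrow> nat) set" where
  "row_stab N t = {\<sigma>. \<sigma> permutes {..<N} \<and> (\<forall>k<N. fst (t (\<sigma> k)) = fst (t k))}"

definition col_stab :: "nat \<Rightarrow> (nat \<Rightarrow> nat \<times> nat) \<Rightarrow> (nat \<Rightarrow> nat) set" where
  "col_stab N t = {\<sigma>. \<sigma> permutes {..<N} \<and> (\<forall>k<N. snd (t (\<sigma> k)) = snd (t k))}"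

text \<open>e_t = \<Sum> \<epsilon>(\<tau>) \<sigma>\<tau>  and  \<tilde>e_t = \<Sum> \<epsilon>(\<tau>) \<tau>\<sigma>, acting on X^{\<otimes>N}.\<close>
definition young_e :: "nat \<Rightarrow> nat \<Rightarrow> (nat \<Rightarrow> nat \<times> nat) \<Rightarrow> (nat list \<Rightarrow> 'a::field) \<Rightarrow> nat list \<Rightarrow> 'a" where
  "young_e n N t f = (\<lambda>K. \<Sum>\<tau>\<in>col_stab N t. \<Sum>\<sigma>\<in>row_stab N t.
      of_int (sign \<tau>) * perm_act n \<sigma> (perm_act n \<tau> f) K)"

definition young_e_tilde :: "nat \<Rightarrow> nat \<Rightarrow> (nat \<Rightarrow> nat \<times> nat) \<Rightarrow> (nat list \<Rightarrow> 'a::field) \<Rightarrow> nat list \<Rightarrow> 'a" where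
  "young_e_tilde n N t f = (\<lambda>K. \<Sum>\<tau>\<in>col_stab N t. \<Sum>\<sigma>\<in>row_stab N t.
      of_int (sign \<tau>) * perm_act n \<tau> (perm_act n \<sigma> f) K)"

text \<open>The tableau t: n+h rows, m columns; t_1 (first n rows) filled with 1..nm column by
column, t_2 (last h rows) filled with nm+1..nm+hm column by column.\<close>
definition tab_t :: "nat \<Rightarrow> nat \<Rightarrow> nat \<Rightarrow> nat \<Rightarrow> nat \<times> nat" where
  "tab_t n m h k = (if k < n * m then (k mod n, k div n)
                    else (n + (k - n * m) mod h, (k - n * m) div h))"

text \<open>The tableau s: n rows, h+m columns; s_1 (first h columns) filled with 1..hn column
by column, s_2 (last m columns) filled with hn+1..hn+mn column by column.\<close>
definition tab_s :: "nat \<Rightarrow> nat \<Rightarrow> nat \<Rightarrow> nat \<Rightarrow> nat \<times> nat" where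
  "tab_s n m h k = (if k < h * n then (k mod n, k div n)
                    else ((k - h * n) mod n, h + (k - h * n) div n))"

definition I_seq :: "nat \<Rightarrow> nat \<Rightarrow> nat list" where
  "I_seq n h = concat (replicate h [0..<n])"

definition J_seq :: "nat \<Rightarrow> nat \<Rightarrow> nat \<Rightarrow> nat list" where
  "J_seq n m h = concat (map (\<lambda>j. replicate h (n + j)) [0..<m])"

text \<open>The element  \<Sum>_L (-1)^{\<alpha>(L,L)+p(L)} e_s(v^*_{I_h} \<otimes> v^*_L) \<otimes> \<tilde>e_t(v_L \<otimes> v_{J_h}).\<close>
definition the_element :: "nat \<Rightarrow> nat \<Rightarrow> nat \<Rightarrow> nat list \<Rightarrow> nat list \<Rightarrow> 'a::field" where
  "the_element n m h = (\<lambda>I K. \<Sum>L\<in>seqs (n + m) (n * m).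
      (-1) ^ (alphaL n L + parL n L)
      * young_e n ((m + h) * n) (tab_s n m h) (basis_vec (I_seq n h @ L)) I
      * young_e_tilde n ((n + h) * m) (tab_t n m h) (basis_vec (L @ J_seq n m h)) K)"

text \<open>Action of the elementary matrix E_{ab} (parity p(a)+p(b)), E_{ab} e_c = \<delta>_{bc} e_a,
on V^{*\<otimes>A} \<otimes> V^{\<otimes>B} (coefficient form). On V^* the action is
(x f)(v) = -(-1)^{p(x)p(f)} f(x v), i.e. E_{ab} e^*_c = -(-1)^{(p(a)+p(b))p(a)} \<delta>_{ca} e^*_b;
on tensor products the super Leibniz rule with Koszul signs is used.\<close>
definition actE :: "nat \<Rightarrow> nat \<Rightarrow> nat \<Rightarrow> (nat list \<Rightarrow> nat list \<Rightarrow> 'a::field) \<Rightarrow> nat list \<Rightarrow> nat list \<Rightarrow> 'a" where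
  "actE n a b W = (\<lambda>I K.
     let px = par n a + par n b in
     (\<Sum>k<length I. if I ! k = b then
         - ((-1) ^ (px * par n a) * (-1) ^ (px * parL n (take k I)) * W (I[k := a]) K)
       else 0)
   + (\<Sum>k<length K. if K ! k = a then
         (-1) ^ (px * (parL n I + parL n (take k K))) * W I (K[k := b])
       else 0))"

text \<open>Action of a general x = \<Sum> x_{ab} E_{ab} \<in> gl(V).\<close>
definition act_gl :: "nat \<Rightarrow> nat \<Rightarrow> (nat \<Rightarrow> nat \<Rightarrow> 'a::field) \<Rightarrow> (nat list \<Rightarrow> nat list \<Rightarrow> 'a) \<Rightarrow> nat list \<Rightarrow> nat list \<Rightarrow> 'a" where
  "act_gl n m x W = (\<lambda>I K. \<Sum>a<n + m. \<Sum>b<n + m. x a b * actE n a b W I K)"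

definition supertrace :: "nat \<Rightarrow> nat \<Rightarrow> (nat \<Rightarrow> nat \<Rightarrow> 'a::field) \<Rightarrow> 'a" where
  "supertrace n m x = (\<Sum>a<n + m. (-1) ^ par n a * x a a)"

text \<open>W \<in> V^{*\<otimes>A} \<otimes> V^{\<otimes>B} is sl(V)-invariant.\<close>
definition sl_invariant :: "nat \<Rightarrow> nat \<Rightarrow> nat \<Rightarrow> nat \<Rightarrow> (nat list \<Rightarrow> nat list \<Rightarrow> 'a::field) \<Rightarrow> bool" where
  "sl_invariant n m A B W \<longleftrightarrow>
     (\<forall>x. supertrace n m x = 0 \<longrightarrow>
        (\<forall>I\<in>seqs (n + m) A. \<forall>K\<in>seqs (n + m) B. act_gl n m x W I K = 0))"

end

theory Submission
  imports Defs
begin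

text \<open>
The permutation action commutes with gl(V) and the canonical tensor \<theta> is gl(V)-invariant, so an
elementary matrix E(a,b) acts on the element only through v^*_I and v_J (with I = I_h, J = J_h).
The row stabilizer of t and the column stabilizer of s act first, and they kill everything except
two cases: a = b, which yields -h times the supertrace, and a even, b odd, which yields for
each i < h a combination of \<open>I[a := b] \<otimes> \<theta> \<otimes> J\<close> and \<open>I \<otimes> \<theta> \<otimes> J[b := a]\<close> (one letter changed in
the i-th column of s_1 and the i-th row of t_2).

Modulo the same two stabilizers this combination is the full sum over l of
\<open>I[a := l] \<otimes> \<theta> \<otimes> J[b := l]\<close>, which has nm + 1 contracted pairs of positions (one in V^*, one in V).
After fixing a column permutation of s and a row permutation of t, each pair lies in a cell
(row of s, column of t) of an n by m grid, so two pairs share a cell. Swapping these two pairs fixes the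
tensor, but belongs to R_s x C_t and has sign -1 there; hence the tensor is annihilated.
\<close>

text \<open>The difficulty lies in the signs. The layout of the tableaux fits the parities: a column
  of the first part of \<open>s\<close> holds each even letter once, and a repeated even letter,
  fixed by a swap, cancels in the signed column sum; a row of the last part of \<open>t\<close>
  holds each odd letter once, and a repeated odd letter, which changes sign under a swap, cancels in
  the unsigned row sum. For two contracted pairs the swap is absorbed by the unsigned row group of
  \<open>s\<close> and the signed column group of \<open>t\<close>, so the tensor has to be fixed
  without any sign. Two facts provide this. The coefficient of theta depends only on the number k of
  odd letters of L, because alpha(L,L) = k(k-1)/2; it equals (-1)^(k(k+1)/2). And the additional
  pair with letter l at position q of J gets the weight (-1)^(p(l)(1+q)): moving an odd letter from
  there into L passes k + q odd letters in all, while the coefficient of theta changes by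
  (-1)^(k+1), which leaves (-1)^(1+q).\<close>

section \<open>Koszul signs\<close>

text \<open>The sign c(\<pi>K, \<pi>) expressed through K, so that K need not be permuted first.\<close>

definition koszul :: "nat \<Rightarrow> (nat \<Rightarrow> nat) \<Rightarrow> nat list \<Rightarrow> 'a::field" where
  "koszul n \<pi> K = (\<Prod>(k, l)\<in>{(k, l). k < l \<and> l < length K}.
     if \<pi> l < \<pi> k \<and> par n (K ! k) = 1 \<and> par n (K ! l) = 1 then - 1 else 1)"

lemma finite_pairs_less [simp]: "finite {(k::nat, l). k < l \<and> l < N}"
  by (rule finite_subset[of _ "{..<N} \<times> {..<N}"]) auto

lemma par_cases: "par n i = 0 \<or> par n i = 1"
  by (simp add: par_def)

lemma length_seq_act [simp]: "length (seq_act \<pi> K) = length K"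
  by (simp add: seq_act_def)

lemma nth_seq_act: "k < length K \<Longrightarrow> seq_act \<pi> K ! k = K ! inv \<pi> k"
  by (simp add: seq_act_def)

lemma permutes_lessThan_less:
  "\<pi> permutes {..<N} \<Longrightarrow> \<pi> k < N \<longleftrightarrow> k < N"
  using permutes_in_image by fastforce

lemma nth_seq_act_perm:
  assumes "\<pi> permutes {..<length K}" "k < length K"
  shows "seq_act \<pi> K ! \<pi> k = K ! k"
  using assms by (simp add: nth_seq_act permutes_lessThan_less permutes_inverses)

lemma seq_act_comp:
  assumes "\<pi> permutes {..<length K}" "\<rho> permutes {..<length K}"
  shows "seq_act (\<rho> \<circ> \<pi>) K = seq_act \<rho> (seq_act \<pi> K)"
proof (rule nth_equalityI)
  fix k assume k: "k < length (seq_act (\<rho> \<circ> \<pi>) K)"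
  then have "inv \<rho> k < length K"
    using assms(2) by (simp add: permutes_inv permutes_lessThan_less)
  moreover have "inv (\<rho> \<circ> \<pi>) = inv \<pi> \<circ> inv \<rho>"
    using assms by (meson o_inv_distrib permutes_bij)
  ultimately show "seq_act (\<rho> \<circ> \<pi>) K ! k = seq_act \<rho> (seq_act \<pi> K) ! k"
    using k by (simp add: nth_seq_act)
qed simp

lemma seq_act_in_seqs:
  assumes "\<pi> permutes {..<N}" "K \<in> seqs d N"
  shows "seq_act \<pi> K \<in> seqs d N"
proof -
  have len: "length K = N" using assms by (simp add: seqs_def)
  have "inv \<pi> k < N" if "k < N" for k
    using that assms(1) by (simp add: permutes_inv permutes_lessThan_less)
  then have "K ! inv \<pi> k \<in> set K" if "k < N" for k
    using that len by auto
  with assms(2) len show ?thesis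
    by (fastforce simp: seqs_def seq_act_def)
qed

text \<open>The letter of \<open>seq_act \<pi> K\<close> at position \<open>\<pi> k\<close> is
  \<open>K ! k\<close>, so the inverted odd pairs can be counted on \<open>K\<close> itself.\<close>

lemma csign_seq_act:
  assumes "\<pi> permutes {..<length K}"
  shows "csign n (seq_act \<pi> K) \<pi> = koszul n \<pi> K"
proof -
  let ?P = "{(k, l). k < l \<and> l < length K}"
  let ?B = "{(k, l). k < l \<and> l < length K \<and> \<pi> l < \<pi> k \<and> par n (K ! k) = 1 \<and> par n (K ! l) = 1}"
  have "{(k, l). k < l \<and> l < length (seq_act \<pi> K) \<and> \<pi> l < \<pi> k
            \<and> par n (seq_act \<pi> K ! \<pi> k) = 1 \<and> par n (seq_act \<pi> K ! \<pi> l) = 1} = ?B"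
    using assms by (auto simp: nth_seq_act_perm)
  moreover have "koszul n \<pi> K = (\<Prod>x\<in>?B. - 1 :: 'a)"
    unfolding koszul_def by (rule prod.mono_neutral_cong_right) (auto split: if_splits)
  ultimately show ?thesis
    by (simp add: csign_def)
qed

text \<open>The composite inverts a pair of odd letters iff exactly one of the two steps does, so
  the factors multiply pair by pair.\<close>

lemma koszul_comp:
  assumes \<pi>: "\<pi> permutes {..<length K}" and \<rho>: "\<rho> permutes {..<length K}"
  shows "koszul n (\<rho> \<circ> \<pi>) K = koszul n \<pi> K * koszul n \<rho> (seq_act \<pi> K)"
proof -
  let ?P = "{(k, l). k < l \<and> l < length K}"
  \<comment> \<open>Unordered pairs are represented by increasing ones, so the image of a pair has
    to be sorted again.\<close>
  let ?s = "\<lambda>\<pi> (k, l). (min (\<pi> k) (\<pi> l), max (\<pi> k) (\<pi> l :: nat))"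
  let ?g = "\<lambda>(k, l). if \<rho> l < \<rho> k \<and> par n (seq_act \<pi> K ! k) = 1 \<and> par n (seq_act \<pi> K ! l) = 1
                   then - 1 else 1 :: 'a"
  have inj: "\<pi> x = \<pi> y \<longleftrightarrow> x = y" "\<rho> x = \<rho> y \<longleftrightarrow> x = y" "inv \<pi> x = inv \<pi> y \<longleftrightarrow> x = y" for x y
    using permutes_inj[OF \<pi>] permutes_inj[OF \<rho>] permutes_inj[OF permutes_inv[OF \<pi>]]
    by (auto dest: injD)
  have lt: "\<pi> x < length K \<longleftrightarrow> x < length K" "inv \<pi> x < length K \<longleftrightarrow> x < length K" for x
    using \<pi> by (simp_all add: permutes_inv permutes_lessThan_less)
  have inverse: "inv \<pi> (\<pi> x) = x" "\<pi> (inv \<pi> x) = x" for x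
    using \<pi> by (simp_all add: permutes_inverses)
  have "koszul n \<rho> (seq_act \<pi> K) = prod ?g ?P"
    by (simp add: koszul_def)
  also have "\<dots> = (\<Prod>x\<in>?P. ?g (?s \<pi> x))"
  proof (rule prod.reindex_bij_witness[of _ "?s \<pi>" "?s (inv \<pi>)"])
    fix x assume "x \<in> ?P"
    then show "?s \<pi> (?s (inv \<pi>) x) = x" "?s (inv \<pi>) x \<in> ?P"
      using inj lt inverse by (auto simp: min_def max_def not_le le_less not_less_iff_gr_or_eq)
  next
    fix x assume "x \<in> ?P"
    then show "?s (inv \<pi>) (?s \<pi> x) = x" "?s \<pi> x \<in> ?P"
      using inj lt inverse by (auto simp: min_def max_def not_le le_less not_less_iff_gr_or_eq)
  next
    fix x assume x: "x \<in> ?P"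
    obtain k l where [simp]: "x = (k, l)" by (cases x)
    have "?s \<pi> (?s (inv \<pi>) x) = x"
      using x inj inverse by (auto simp: min_def max_def not_le le_less)
    then show "?g (?s \<pi> (?s (inv \<pi>) x)) = ?g x" by (simp only:)
  qed
  finally have *: "koszul n \<rho> (seq_act \<pi> K) = (\<Prod>x\<in>?P. ?g (?s \<pi> x))" .
  show ?thesis
    unfolding * unfolding koszul_def prod.distrib[symmetric]
  proof (rule prod.cong[OF refl], clarify, goal_cases)
    case (1 k l)
    note kl = 1
    then have "seq_act \<pi> K ! \<pi> k = K ! k" "seq_act \<pi> K ! \<pi> l = K ! l"
      using \<pi> by (simp_all add: nth_seq_act_perm)
    moreover have "\<pi> k \<noteq> \<pi> l" "\<rho> (\<pi> k) \<noteq> \<rho> (\<pi> l)" using kl inj by auto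
    ultimately show ?case
      by (auto simp: min_def max_def)
  qed
qed

lemma koszul_square: "koszul n \<pi> K * koszul n \<pi> K = (1::'a::field)"
  unfolding koszul_def prod.distrib[symmetric] by (rule prod.neutral) auto

lemma sgn_parL_take:
  assumes "j \<le> length K"
  shows "(- 1 :: 'a::field) ^ parL n (take j K) =
    (\<Prod>i<length K. if i < j \<and> par n (K ! i) = 1 then - 1 else 1)"
proof -
  have "parL n (take j K) = (\<Sum>i<j. par n (K ! i))"
    using assms by (simp add: parL_def min_def)
  then have "(- 1 :: 'a) ^ parL n (take j K) = (\<Prod>i<j. (- 1) ^ par n (K ! i))"
    by (simp add: power_sum)
  also have "\<dots> = (\<Prod>i<length K. if i < j \<and> par n (K ! i) = 1 then - 1 else 1)"
    using assms by (intro prod.mono_neutral_cong_left) (auto simp: par_def)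
  finally show ?thesis .
qed

text \<open>Changing the parity of the letter at \<open>j\<close> toggles exactly the factors of
  pairs formed by \<open>j\<close> and an odd letter whose order relative to \<open>j\<close> is
  reversed by \<open>\<pi>\<close>. The same letters make up the difference between the odd letters
  in front of \<open>j\<close> and those in front of its image, so both changes of sign
  agree.\<close>

lemma koszul_update:
  assumes \<pi>: "\<pi> permutes {..<length K}" and j: "j < length K"
    and par: "par n (K ! j) + par n b = 1"
  shows "koszul n \<pi> (K[j := b]) * (- 1) ^ parL n (take j K)
       = (koszul n \<pi> K * (- 1) ^ parL n (take (\<pi> j) (seq_act \<pi> K)) :: 'a::field)"
proof -
  let ?N = "length K"
  let ?P = "{(k, l). k < l \<and> l < ?N}"
  \<comment> \<open>This is -1 at the odd letters whose order relative to \<open>j\<close> changes.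
    At \<open>i = j\<close> it is 1, so \<open>j\<close> may be included or omitted in the products
    below.\<close>
  let ?f = "\<lambda>i. if (i < j) \<noteq> (\<pi> i < \<pi> j) \<and> par n (K ! i) = 1 then - 1 else 1 :: 'a"
  let ?h = "\<lambda>(k, l). if k = j then ?f l else if l = j then ?f k else 1"
  have inj: "\<pi> x = \<pi> y \<longleftrightarrow> x = y" for x y
    using permutes_inj[OF \<pi>] by (auto dest: injD)
  have "(- 1 :: 'a) ^ parL n (take (\<pi> j) (seq_act \<pi> K)) =
    (\<Prod>i<?N. if i < \<pi> j \<and> par n (seq_act \<pi> K ! i) = 1 then - 1 else 1)"
    using \<pi> j by (subst sgn_parL_take) (auto simp: permutes_lessThan_less less_imp_le)
  also have "\<dots> = (\<Prod>i<?N. if \<pi> i < \<pi> j \<and> par n (seq_act \<pi> K ! \<pi> i) = 1 then - 1 else 1)"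
    by (subst prod.permute[OF \<pi>]) (simp add: o_def)
  also have "\<dots> = (\<Prod>i<?N. if \<pi> i < \<pi> j \<and> par n (K ! i) = 1 then - 1 else 1)"
    using \<pi> by (intro prod.cong) (auto simp: nth_seq_act_perm)
  finally have A: "(- 1 :: 'a) ^ parL n (take j K) * (- 1) ^ parL n (take (\<pi> j) (seq_act \<pi> K)) =
      (\<Prod>i<?N. ?f i)"
    using j by (simp add: sgn_parL_take less_imp_le prod.distrib[symmetric] if_distrib cong: if_cong)
      (intro prod.cong; auto)
  have "koszul n \<pi> (K[j := b]) * koszul n \<pi> K = (\<Prod>x\<in>?P. ?h x)"
    unfolding koszul_def length_list_update prod.distrib[symmetric]
  proof (rule prod.cong[OF refl], clarify, goal_cases)
    case (1 k l)
    note kl = 1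
    then have "\<pi> k \<noteq> \<pi> l" using inj by auto
    with kl par j inj show ?case
      using par_cases[of n b] by (auto simp: nth_list_update)
  qed
  also have "\<dots> = (\<Prod>x\<in>{x\<in>?P. fst x = j \<or> snd x = j}. ?h x)"
    by (rule prod.mono_neutral_right) (simp, blast, clarsimp, rule ccontr, simp)
  also have "\<dots> = (\<Prod>i\<in>{..<?N} - {j}. ?f i)"
    by (rule prod.reindex_bij_witness[of _ "\<lambda>i. (min i j, max i j)" "\<lambda>(k, l). if k = j then l else k"])
       (use j in \<open>auto simp: min_def max_def split: if_splits\<close>)
  also have "\<dots> = (\<Prod>i<?N. ?f i)"
    using j by (intro prod.mono_neutral_left) auto
  finally have "koszul n \<pi> (K[j := b]) * koszul n \<pi> K
     = (- 1 :: 'a) ^ parL n (take j K) * (- 1) ^ parL n (take (\<pi> j) (seq_act \<pi> K))"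
    using A by simp
  then have "koszul n \<pi> (K[j := b]) * (koszul n \<pi> K * koszul n \<pi> K) * (- 1 :: 'a) ^ parL n (take j K)
     = koszul n \<pi> K * (- 1) ^ parL n (take (\<pi> j) (seq_act \<pi> K))
       * ((- 1 :: 'a) ^ parL n (take j K) * (- 1) ^ parL n (take j K))"
    by (simp add: mult.assoc[symmetric])
  then show ?thesis
    by (simp add: koszul_square flip: power_add mult_2)
qed

text \<open>Exchanging \<open>p < q\<close> inverts three kinds of pairs: \<open>(p, q)\<close>
  itself, and \<open>(p, j)\<close> and \<open>(j, q)\<close> for each \<open>j\<close> strictly
  between.\<close>

lemma koszul_transpose:
  assumes pq: "p < q" "q < length K"
  shows "(koszul n (transpose p q) K :: 'a::field) =
    (- 1) ^ (par n (K ! p) * par n (K ! q) + (par n (K ! p) + par n (K ! q)) * (\<Sum>j\<in>{p<..<q}. par n (K ! j)))"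
proof -
  let ?P = "{(k, l). k < l \<and> l < length K}"
  let ?g = "\<lambda>(k, l). (- 1 :: 'a) ^ (par n (K ! k) * par n (K ! l))"
  let ?B = "{p<..<q}"
  have T: "k < l \<and> transpose p q l < transpose p q k \<longleftrightarrow>
     (k = p \<and> l = q) \<or> (k = p \<and> l \<in> ?B) \<or> (l = q \<and> k \<in> ?B)" for k l
    using pq by (auto simp: transpose_def)
  have "koszul n (transpose p q) K = (\<Prod>x\<in>insert (p, q) ((\<lambda>j. (p, j)) ` ?B \<union> (\<lambda>j. (j, q)) ` ?B). ?g x)"
    unfolding koszul_def
  proof (rule prod.mono_neutral_cong_right)
    show "insert (p, q) ((\<lambda>j. (p, j)) ` ?B \<union> (\<lambda>j. (j, q)) ` ?B) \<subseteq> ?P"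
      using pq by auto
    have no: "\<not> transpose p q l < transpose p q k"
      if "k < l" "(k, l) \<notin> insert (p, q) ((\<lambda>j. (p, j)) ` ?B \<union> (\<lambda>j. (j, q)) ` ?B)" for k l
      using T[of k l] that by auto
    show "\<forall>x\<in>?P - insert (p, q) ((\<lambda>j. (p, j)) ` ?B \<union> (\<lambda>j. (j, q)) ` ?B).
      (case x of (k, l) \<Rightarrow> if transpose p q l < transpose p q k \<and> par n (K ! k) = 1 \<and> par n (K ! l) = 1 then - 1 else (1::'a)) = 1" (is "\<forall>x\<in>_. ?Q x")
    proof
      fix x assume x: "x \<in> ?P - insert (p, q) ((\<lambda>j. (p, j)) ` ?B \<union> (\<lambda>j. (j, q)) ` ?B)"
      obtain k l where "x = (k, l)" by (cases x)
      with x no[of k l] show "?Q x" by auto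
    qed
    show "(case x of (k, l) \<Rightarrow> if transpose p q l < transpose p q k \<and> par n (K ! k) = 1 \<and> par n (K ! l) = 1 then - 1 else 1) = ?g x"
      if "x \<in> insert (p, q) ((\<lambda>j. (p, j)) ` ?B \<union> (\<lambda>j. (j, q)) ` ?B)" for x
    proof -
      obtain k l where x: "x = (k, l)" by (cases x)
      with that have "transpose p q l < transpose p q k" using T[of k l] pq by auto
      then show ?thesis using x par_cases[of n "K ! k"] par_cases[of n "K ! l"] by auto
    qed
  qed auto
  also have "\<dots> = ?g (p, q) * ((\<Prod>x\<in>(\<lambda>j. (p, j)) ` ?B. ?g x) * (\<Prod>x\<in>(\<lambda>j. (j, q)) ` ?B. ?g x))"
    by (subst prod.insert) (auto intro!: prod.union_disjoint)
  also have "(\<Prod>x\<in>(\<lambda>j. (p, j)) ` ?B. ?g x) = (- 1) ^ (par n (K ! p) * (\<Sum>j\<in>?B. par n (K ! j)))"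
    by (subst prod.reindex) (auto simp: inj_on_def power_sum sum_distrib_left)
  also have "(\<Prod>x\<in>(\<lambda>j. (j, q)) ` ?B. ?g x) = (- 1) ^ (par n (K ! q) * (\<Sum>j\<in>?B. par n (K ! j)))"
    by (subst prod.reindex) (auto simp: inj_on_def power_sum sum_distrib_left mult.commute)
  finally show ?thesis
    by (simp add: power_add distrib_right)
qed

section \<open>Permutations and Young symmetrizers on both factors\<close>

text \<open>\<sigma> acts on the factors V^*, \<sigma>' on the factors V.\<close>

definition bi_act :: "nat \<Rightarrow> (nat \<Rightarrow> nat) \<Rightarrow> (nat \<Rightarrow> nat) \<Rightarrow> (nat list \<Rightarrow> nat list \<Rightarrow> 'a::field)
    \<Rightarrow> nat list \<Rightarrow> nat list \<Rightarrow> 'a" where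
  "bi_act n \<sigma> \<sigma>' F = (\<lambda>I K. koszul n (inv \<sigma>) I * koszul n (inv \<sigma>') K *
     F (seq_act (inv \<sigma>) I) (seq_act (inv \<sigma>') K))"

lemma perm_act_koszul:
  assumes "\<sigma> permutes {..<length K}"
  shows "perm_act n \<sigma> f K = koszul n (inv \<sigma>) K * f (seq_act (inv \<sigma>) K)"
  using assms by (simp add: perm_act_def csign_seq_act permutes_inv)

lemma bi_act_comp:
  assumes "\<sigma> permutes {..<length I}" "\<tau> permutes {..<length I}"
    and "\<sigma>' permutes {..<length K}" "\<tau>' permutes {..<length K}"
  shows "bi_act n \<sigma> \<sigma>' (bi_act n \<tau> \<tau>' F) I K = bi_act n (\<sigma> \<circ> \<tau>) (\<sigma>' \<circ> \<tau>') F I K"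
proof -
  have "inv (\<sigma> \<circ> \<tau>) = inv \<tau> \<circ> inv \<sigma>" "inv (\<sigma>' \<circ> \<tau>') = inv \<tau>' \<circ> inv \<sigma>'"
    using assms by (auto intro!: o_inv_distrib permutes_bij)
  with assms show ?thesis
    by (simp add: bi_act_def koszul_comp seq_act_comp permutes_inv)
qed

lemma bi_act_cong:
  assumes "\<sigma> permutes {..<A}" "\<sigma>' permutes {..<B}" "I \<in> seqs d A" "K \<in> seqs d B"
    and "\<And>I K. I \<in> seqs d A \<Longrightarrow> K \<in> seqs d B \<Longrightarrow> F I K = G I K"
  shows "bi_act n \<sigma> \<sigma>' F I K = bi_act n \<sigma> \<sigma>' G I K"
  using assms by (simp add: bi_act_def seq_act_in_seqs permutes_inv)

section \<open>The action of gl(V) commutes with permutations of positions\<close>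

lemma seq_act_update:
  assumes "\<pi> permutes {..<length K}" "k < length K"
  shows "seq_act \<pi> (K[k := y]) = (seq_act \<pi> K)[\<pi> k := y]"
proof (rule nth_equalityI)
  fix i assume i: "i < length (seq_act \<pi> (K[k := y]))"
  have "inv \<pi> i < length K \<longleftrightarrow> i < length K" "\<pi> k < length K"
    using assms by (simp_all add: permutes_inv permutes_lessThan_less)
  moreover have "inv \<pi> i = k \<longleftrightarrow> i = \<pi> k"
    using permutes_inverses[OF assms(1)] by auto
  ultimately show "seq_act \<pi> (K[k := y]) ! i = (seq_act \<pi> K)[\<pi> k := y] ! i"
    using i by (auto simp: nth_seq_act nth_list_update)
qed simp

lemma parL_seq_act:
  assumes "\<pi> permutes {..<length K}"
  shows "parL n (seq_act \<pi> K) = parL n K"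
proof -
  have "parL n (seq_act \<pi> K) = (\<Sum>i<length K. par n (seq_act \<pi> K ! \<pi> i))"
    unfolding parL_def length_seq_act by (subst sum.permute[OF assms]) (simp add: o_def)
  then show ?thesis
    using assms by (simp add: parL_def nth_seq_act_perm)
qed

text \<open>If the parity of the letter does not change, the Koszul sign stays the same and both
  exponents are even; the other case is \<open>koszul_update\<close>.\<close>

lemma koszul_update_any:
  assumes \<pi>: "\<pi> permutes {..<length K}" and j: "j < length K"
  shows "koszul n \<pi> (K[j := b]) * (- 1) ^ ((par n (K ! j) + par n b) * parL n (take j K))
       = (koszul n \<pi> K * (- 1) ^ ((par n (K ! j) + par n b) * parL n (take (\<pi> j) (seq_act \<pi> K))) :: 'a::field)"
proof (cases "par n (K ! j) + par n b = 1")
  case True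
  then show ?thesis using koszul_update[OF \<pi> j True, where 'a = 'a] by simp
next
  case False
  then have eq: "par n (K ! j) = par n b"
    using par_cases[of n b] par_cases[of n "K ! j"] by auto
  then have "par n (K[j := b] ! i) = par n (K ! i)" for i
    using j by (cases "i = j") auto
  then have "koszul n \<pi> (K[j := b]) = (koszul n \<pi> K :: 'a)"
    by (simp add: koszul_def)
  moreover have "(- 1 :: 'a) ^ ((par n b + par n b) * x) = 1" for x
    by (simp flip: mult_2 add: power_mult)
  ultimately show ?thesis by (simp add: eq)
qed

text \<open>One tensor factor of the commutation with gl(V): replacing a letter at \<open>k\<close>
  and then permuting is the same as permuting and then replacing at \<open>\<pi> k\<close>, and
  \<open>koszul_update_any\<close> trades the Leibniz sign of one position for that of the
  other.\<close>

lemma sum_letter_seq_act: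
  assumes \<pi>: "\<pi> permutes {..<length K}"
  shows "(\<Sum>k<length K. if K ! k = x then (- 1) ^ ((par n x + par n y) * parL n (take k K))
            * (koszul n \<pi> (K[k := y]) * g (seq_act \<pi> (K[k := y]))) else 0)
     = koszul n \<pi> K * (\<Sum>k<length K. if seq_act \<pi> K ! k = x
            then (- 1) ^ ((par n x + par n y) * parL n (take k (seq_act \<pi> K))) * g ((seq_act \<pi> K)[k := y])
            else (0::'a::field))"
proof -
  have "(\<Sum>k<length K. if seq_act \<pi> K ! k = x
            then (- 1) ^ ((par n x + par n y) * parL n (take k (seq_act \<pi> K))) * g ((seq_act \<pi> K)[k := y])
            else (0::'a)) = (\<Sum>k<length K. if K ! k = x
            then (- 1) ^ ((par n x + par n y) * parL n (take (\<pi> k) (seq_act \<pi> K))) * g ((seq_act \<pi> K)[\<pi> k := y])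
            else 0)"
    by (subst sum.permute[OF \<pi>]) (use \<pi> in \<open>auto simp: nth_seq_act_perm intro!: sum.cong\<close>)
  then have "koszul n \<pi> K * (\<Sum>k<length K. if seq_act \<pi> K ! k = x
            then (- 1) ^ ((par n x + par n y) * parL n (take k (seq_act \<pi> K))) * g ((seq_act \<pi> K)[k := y])
            else (0::'a)) = (\<Sum>k<length K. if K ! k = x
            then (koszul n \<pi> K * (- 1) ^ ((par n x + par n y) * parL n (take (\<pi> k) (seq_act \<pi> K)))) * g ((seq_act \<pi> K)[\<pi> k := y])
            else 0)"
    by (simp add: sum_distrib_left if_distrib mult.assoc cong: if_cong)
  also have "\<dots> = (\<Sum>k<length K. if K ! k = x then (- 1) ^ ((par n x + par n y) * parL n (take k K))
            * (koszul n \<pi> (K[k := y]) * g (seq_act \<pi> (K[k := y]))) else 0)"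
    using koszul_update_any[OF \<pi>, of _ n y, where 'a = 'a]
    by (intro sum.cong) (auto simp: seq_act_update[OF \<pi>] mult_ac)
  finally show ?thesis ..
qed

text \<open>Both Leibniz sums are brought into the shape of \<open>sum_letter_seq_act\<close>, with
  the roles of \<open>a\<close> and \<open>b\<close> interchanged on the dual factor.\<close>

lemma actE_split:
  "actE n a b G I K =
      - ((- 1) ^ ((par n a + par n b) * par n a)) * (\<Sum>k<length I. if I ! k = b
            then (- 1) ^ ((par n b + par n a) * parL n (take k I)) * G (I[k := a]) K else 0)
     + (- 1) ^ ((par n a + par n b) * parL n I) * (\<Sum>k<length K. if K ! k = a
            then (- 1) ^ ((par n a + par n b) * parL n (take k K)) * G I (K[k := b]) else 0)"
  unfolding actE_def Let_def
  by (simp add: sum_distrib_left if_distrib power_add distrib_left add.commute mult.assoc cong: if_cong)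

text \<open>The two factors are coupled only by the sign for passing the whole dual factor. It
  depends on \<open>parL n I\<close> alone, which a permutation of positions preserves.\<close>

lemma actE_bi_act:
  assumes \<sigma>: "\<sigma> permutes {..<length I}" and \<sigma>': "\<sigma>' permutes {..<length K}"
  shows "actE n a b (bi_act n \<sigma> \<sigma>' F) I K = bi_act n \<sigma> \<sigma>' (actE n a b F) I K"
proof -
  let ?\<pi> = "inv \<sigma>" and ?\<rho> = "inv \<sigma>'"
  let ?px = "par n a + par n b"
  have \<pi>: "?\<pi> permutes {..<length I}" and \<rho>: "?\<rho> permutes {..<length K}"
    using \<sigma> \<sigma>' by (simp_all add: permutes_inv)
  have "(\<Sum>k<length I. if I ! k = b
            then (- 1) ^ ((par n b + par n a) * parL n (take k I)) * bi_act n \<sigma> \<sigma>' F (I[k := a]) K else 0)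
      = koszul n ?\<rho> K * (\<Sum>k<length I. if I ! k = b then (- 1) ^ ((par n b + par n a) * parL n (take k I))
            * (koszul n ?\<pi> (I[k := a]) * F (seq_act ?\<pi> (I[k := a])) (seq_act ?\<rho> K)) else 0)"
    by (simp add: bi_act_def sum_distrib_left if_distrib mult_ac cong: if_cong)
  moreover have "(\<Sum>k<length K. if K ! k = a
            then (- 1) ^ (?px * parL n (take k K)) * bi_act n \<sigma> \<sigma>' F I (K[k := b]) else 0)
      = koszul n ?\<pi> I * (\<Sum>k<length K. if K ! k = a then (- 1) ^ (?px * parL n (take k K))
            * (koszul n ?\<rho> (K[k := b]) * F (seq_act ?\<pi> I) (seq_act ?\<rho> (K[k := b]))) else 0)"
    by (simp add: bi_act_def sum_distrib_left if_distrib mult_ac cong: if_cong)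
  ultimately show ?thesis
    unfolding bi_act_def[of n \<sigma> \<sigma>' "actE n a b F"] actE_split
    using sum_letter_seq_act[OF \<pi>, of b n a "\<lambda>J. F J (seq_act ?\<rho> K)"]
      sum_letter_seq_act[OF \<rho>, of a n b "\<lambda>J. F (seq_act ?\<pi> I) J"]
    by (simp add: parL_seq_act[OF \<pi>] ring_distribs mult_ac)
qed

text \<open>The operator \<open>e_s \<times> e~_t\<close>.\<close>

definition bi_young :: "nat \<Rightarrow> nat \<Rightarrow> nat \<Rightarrow> (nat \<Rightarrow> nat \<times> nat) \<Rightarrow> (nat \<Rightarrow> nat \<times> nat)
    \<Rightarrow> (nat list \<Rightarrow> nat list \<Rightarrow> 'a::field) \<Rightarrow> nat list \<Rightarrow> nat list \<Rightarrow> 'a" where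
  "bi_young n A B s t F = (\<lambda>I K. \<Sum>(\<tau>, \<sigma>, \<tau>', \<sigma>')\<in>col_stab A s \<times> row_stab A s \<times> col_stab B t \<times> row_stab B t.
     of_int (sign \<tau> * sign \<tau>') * bi_act n \<sigma> \<tau>' (bi_act n \<tau> \<sigma>' F) I K)"

lemma stab_permutes:
  "\<sigma> \<in> row_stab N t \<Longrightarrow> \<sigma> permutes {..<N}" "\<sigma> \<in> col_stab N t \<Longrightarrow> \<sigma> permutes {..<N}"
  by (auto simp: row_stab_def col_stab_def)

lemma bi_young_tensor:
  assumes "length I = A" "length K = B"
  shows "young_e n A s f I * young_e_tilde n B t g K = bi_young n A B s t (\<lambda>I K. f I * g K) I K"
proof -
  have "young_e n A s f I = (\<Sum>(\<tau>, \<sigma>)\<in>col_stab A s \<times> row_stab A s.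
      of_int (sign \<tau>) * perm_act n \<sigma> (perm_act n \<tau> f) I)"
    by (simp add: young_e_def sum.cartesian_product)
  moreover have "young_e_tilde n B t g K = (\<Sum>(\<tau>, \<sigma>)\<in>col_stab B t \<times> row_stab B t.
      of_int (sign \<tau>) * perm_act n \<tau> (perm_act n \<sigma> g) K)"
    by (simp add: young_e_tilde_def sum.cartesian_product)
  ultimately have "young_e n A s f I * young_e_tilde n B t g K =
    (\<Sum>(x, y)\<in>(col_stab A s \<times> row_stab A s) \<times> (col_stab B t \<times> row_stab B t).
      (case x of (\<tau>, \<sigma>) \<Rightarrow> of_int (sign \<tau>) * perm_act n \<sigma> (perm_act n \<tau> f) I) *
      (case y of (\<tau>, \<sigma>) \<Rightarrow> of_int (sign \<tau>) * perm_act n \<tau> (perm_act n \<sigma> g) K))"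
    by (simp only: sum_product sum.cartesian_product)
  also have "\<dots> = bi_young n A B s t (\<lambda>I K. f I * g K) I K"
    unfolding bi_young_def
  proof (rule sum.reindex_bij_witness[of _ "\<lambda>(\<tau>, \<sigma>, \<tau>', \<sigma>'). ((\<tau>, \<sigma>), (\<tau>', \<sigma>'))"
        "\<lambda>((\<tau>, \<sigma>), (\<tau>', \<sigma>')). (\<tau>, \<sigma>, \<tau>', \<sigma>')"], goal_cases)
    case (5 x)
    then obtain \<tau> \<sigma> \<tau>' \<sigma>' where [simp]: "x = ((\<tau>, \<sigma>), (\<tau>', \<sigma>'))"
      and "\<tau> \<in> col_stab A s" "\<sigma> \<in> row_stab A s" "\<tau>' \<in> col_stab B t" "\<sigma>' \<in> row_stab B t"
      by auto
    then have "\<tau> permutes {..<A}" "\<sigma> permutes {..<A}" "\<tau>' permutes {..<B}" "\<sigma>' permutes {..<B}"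
      by (auto dest: stab_permutes)
    with assms show ?case
      by (simp add: perm_act_koszul bi_act_def)
  qed auto
  finally show ?thesis .
qed

lemma bi_act_sum:
  "bi_act n \<sigma> \<sigma>' (\<lambda>I K. \<Sum>i\<in>S. c i * F i I K) = (\<lambda>I K. \<Sum>i\<in>S. c i * bi_act n \<sigma> \<sigma>' (F i) I K)"
  by (simp add: bi_act_def sum_distrib_left mult_ac)

lemma bi_young_sum:
  "bi_young n A B s t (\<lambda>I K. \<Sum>i\<in>S. c i * F i I K) I K = (\<Sum>i\<in>S. c i * bi_young n A B s t (F i) I K)"
proof -
  have "bi_young n A B s t (\<lambda>I K. \<Sum>i\<in>S. c i * F i I K) I K =
    (\<Sum>x\<in>col_stab A s \<times> row_stab A s \<times> col_stab B t \<times> row_stab B t. \<Sum>i\<in>S. c i *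
      (case x of (\<tau>, \<sigma>, \<tau>', \<sigma>') \<Rightarrow> of_int (sign \<tau> * sign \<tau>') * bi_act n \<sigma> \<tau>' (bi_act n \<tau> \<sigma>' (F i)) I K))"
    unfolding bi_young_def
    by (rule sum.cong) (auto simp: bi_act_sum sum_distrib_left mult_ac)
  then show ?thesis
    by (subst (asm) sum.swap) (simp add: bi_young_def sum_distrib_left)
qed

lemma bi_young_cong:
  assumes "I \<in> seqs d A" "K \<in> seqs d B"
    and "\<And>I K. I \<in> seqs d A \<Longrightarrow> K \<in> seqs d B \<Longrightarrow> F I K = G I K"
  shows "bi_young n A B s t F I K = bi_young n A B s t G I K"
  unfolding bi_young_def
  by (rule sum.cong) (use assms in \<open>auto dest!: stab_permutes intro!: bi_act_cong arg_cong2[where f = "(*)"]\<close>)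

lemma actE_sum:
  "actE n a b (\<lambda>I K. \<Sum>i\<in>S. c i * F i I K) I K = (\<Sum>i\<in>S. c i * actE n a b (F i) I K)"
proof -
  have 1: "(\<Sum>k<N. if P k then x k * (\<Sum>i\<in>S. c i * F' i k) else 0) =
      (\<Sum>i\<in>S. c i * (\<Sum>k<N. if P k then x k * F' i k else 0))"
    for N P and x :: "nat \<Rightarrow> 'a" and F'
  proof -
    have "(\<Sum>i\<in>S. c i * (\<Sum>k<N. if P k then x k * F' i k else 0)) =
      (\<Sum>i\<in>S. \<Sum>k<N. c i * (if P k then x k * F' i k else 0))"
      by (simp only: sum_distrib_left)
    also have "\<dots> = (\<Sum>k<N. \<Sum>i\<in>S. c i * (if P k then x k * F' i k else 0))"
      by (rule sum.swap)
    also have "\<dots> = (\<Sum>k<N. if P k then x k * (\<Sum>i\<in>S. c i * F' i k) else 0)"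
      by (intro sum.cong) (auto simp: sum_distrib_left mult_ac)
    finally show ?thesis ..
  qed
  show ?thesis
    unfolding actE_split 1 by (simp add: sum_distrib_left sum.distrib ring_distribs sum_subtractf mult_ac)
qed

lemma actE_bi_young:
  assumes "I \<in> seqs d A" "K \<in> seqs d B" "a < d" "b < d"
  shows "actE n a b (bi_young n A B s t F) I K = bi_young n A B s t (actE n a b F) I K"
proof -
  let ?X = "col_stab A s \<times> row_stab A s \<times> col_stab B t \<times> row_stab B t"
  let ?c = "\<lambda>(\<tau>, \<sigma>, \<tau>', \<sigma>'). of_int (sign \<tau> * sign \<tau>') :: 'a"
  let ?F = "\<lambda>(\<tau>, \<sigma>, \<tau>', \<sigma>'). bi_act n \<sigma> \<tau>' (bi_act n \<tau> \<sigma>' F)"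
  have len: "length I = A" "length K = B" using assms by (auto simp: seqs_def)
  have "bi_young n A B s t F = (\<lambda>I K. \<Sum>x\<in>?X. ?c x * ?F x I K)"
    by (simp add: bi_young_def case_prod_unfold)
  then have "actE n a b (bi_young n A B s t F) I K = (\<Sum>x\<in>?X. ?c x * actE n a b (?F x) I K)"
    by (simp only: actE_sum)
  also have "\<dots> = bi_young n A B s t (actE n a b F) I K"
    unfolding bi_young_def
  proof (rule sum.cong[OF refl], goal_cases)
    case (1 x)
    then obtain \<tau> \<sigma> \<tau>' \<sigma>' where [simp]: "x = (\<tau>, \<sigma>, \<tau>', \<sigma>')"
      and "\<tau> \<in> col_stab A s" "\<sigma> \<in> row_stab A s" "\<tau>' \<in> col_stab B t" "\<sigma>' \<in> row_stab B t"
      by auto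
    then have p: "\<tau> permutes {..<A}" "\<sigma> permutes {..<A}" "\<tau>' permutes {..<B}" "\<sigma>' permutes {..<B}"
      by (auto dest: stab_permutes)
    then have "actE n a b (bi_act n \<sigma> \<tau>' (bi_act n \<tau> \<sigma>' F)) I K = bi_act n \<sigma> \<tau>' (actE n a b (bi_act n \<tau> \<sigma>' F)) I K"
      using len by (simp add: actE_bi_act)
    also have "\<dots> = bi_act n \<sigma> \<tau>' (bi_act n \<tau> \<sigma>' (actE n a b F)) I K"
      by (rule bi_act_cong[OF p(2,3) assms(1,2)]) (use p in \<open>auto simp: actE_bi_act seqs_def\<close>)
    finally show ?case by simp
  qed
  finally show ?thesis .
qed

section \<open>Three cancellation criteria for the double Young symmetrizer\<close>

lemma sum_neg_involution:
  fixes g :: "'b \<Rightarrow> 'a::field_char_0"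
  assumes "\<And>x. x \<in> X \<Longrightarrow> T x \<in> X" "\<And>x. x \<in> X \<Longrightarrow> T (T x) = x" "\<And>x. x \<in> X \<Longrightarrow> g (T x) = - g x"
  shows "sum g X = 0"
proof -
  have "sum g X = (\<Sum>x\<in>X. - g x)"
    by (rule sum.reindex_bij_witness[of _ T T]) (use assms in auto)
  \<comment> \<open>Dividing by 2 is where the characteristic enters; fixed points of
    \<open>T\<close> are harmless.\<close>
  then have "2 * sum g X = 0" by (simp add: sum_negf)
  then show ?thesis by simp
qed

lemma stab_comp_transpose:
  assumes "p < N" "q < N"
  shows "\<sigma> \<in> row_stab N t \<Longrightarrow> fst (t p) = fst (t q) \<Longrightarrow> \<sigma> \<circ> transpose p q \<in> row_stab N t"
    and "\<sigma> \<in> col_stab N t \<Longrightarrow> snd (t p) = snd (t q) \<Longrightarrow> \<sigma> \<circ> transpose p q \<in> col_stab N t"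
  using assms
  by (auto simp: row_stab_def col_stab_def transpose_def intro!: permutes_compose permutes_swap_id)

lemma sign_comp_transpose:
  assumes "\<sigma> permutes {..<N::nat}" "p < N" "q < N" "p \<noteq> q"
  shows "sign (\<sigma> \<circ> transpose p q) = - sign \<sigma>"
proof -
  have "permutation \<sigma>" using assms(1) by (auto simp: permutation_permutes)
  then show ?thesis using assms by (simp add: sign_compose permutation_swap_id sign_swap_id)
qed

text \<open>Multiplying the column permutation, which acts first, by the transposition on the right
  leaves its effect on \<open>F\<close> unchanged and reverses its sign, so the summands
  cancel.\<close>

lemma bi_young_eq_0_col:
  fixes F :: "nat list \<Rightarrow> nat list \<Rightarrow> 'a::field_char_0"
  assumes IK: "I \<in> seqs d A" "K \<in> seqs d B"
    and pq: "p < A" "q < A" "p \<noteq> q" "snd (s p) = snd (s q)"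
    and F: "\<And>I K. I \<in> seqs d A \<Longrightarrow> K \<in> seqs d B \<Longrightarrow> bi_act n (transpose p q) id F I K = F I K"
  shows "bi_young n A B s t F I K = 0"
proof -
  {
    fix \<tau> \<sigma> \<tau>' \<sigma>'
    assume X: "\<tau> \<in> col_stab A s" "\<sigma> \<in> row_stab A s" "\<tau>' \<in> col_stab B t" "\<sigma>' \<in> row_stab B t"
    then have p: "\<tau> permutes {..<A}" "\<sigma> permutes {..<A}" "\<tau>' permutes {..<B}" "\<sigma>' permutes {..<B}"
      by (auto dest: stab_permutes)
    have tr: "transpose p q permutes {..<A}" using pq by (auto intro: permutes_swap_id)
    have mem: "\<tau> \<circ> transpose p q \<in> col_stab A s" using X pq by (auto intro: stab_comp_transpose)
    have inv: "\<tau> \<circ> transpose p q \<circ> transpose p q = \<tau>" by (simp add: comp_assoc)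
    have "bi_act n (\<tau> \<circ> transpose p q) \<sigma>' F I K = bi_act n \<tau> \<sigma>' F I K" if "I \<in> seqs d A" "K \<in> seqs d B" for I K
    proof -
      have "bi_act n (\<tau> \<circ> transpose p q) (\<sigma>' \<circ> id) F I K = bi_act n \<tau> \<sigma>' (bi_act n (transpose p q) id F) I K"
        using that p tr by (subst bi_act_comp) (auto simp: seqs_def)
      then show ?thesis using bi_act_cong[OF p(1,4) that F] by simp
    qed
    then have "bi_act n \<sigma> \<tau>' (bi_act n (\<tau> \<circ> transpose p q) \<sigma>' F) I K = bi_act n \<sigma> \<tau>' (bi_act n \<tau> \<sigma>' F) I K"
      by (rule bi_act_cong[OF p(2,3) IK])
    then have neg: "of_int (sign (\<tau> \<circ> transpose p q) * sign \<tau>') * bi_act n \<sigma> \<tau>' (bi_act n (\<tau> \<circ> transpose p q) \<sigma>' F) I K =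
         - (of_int (sign \<tau> * sign \<tau>') * bi_act n \<sigma> \<tau>' (bi_act n \<tau> \<sigma>' F) I K)"
      using p pq by (simp add: sign_comp_transpose)
    note mem inv neg
  } note key = this
  show ?thesis
    unfolding bi_young_def
  proof (rule sum_neg_involution[where T = "\<lambda>(\<tau>, \<sigma>, \<tau>', \<sigma>'). (\<tau> \<circ> transpose p q, \<sigma>, \<tau>', \<sigma>')"], goal_cases)
    case (1 x)
    then show ?case using key by auto
  next
    case (2 x)
    then show ?case using key by auto
  next
    case (3 x)
    then show ?case using key by (cases x rule: prod_cases4) (simp del: of_int_mult)
  qed
qed

text \<open>Row permutations carry no sign in the symmetrizer, so here the tensor itself must change
  sign, as it does for a repeated odd letter.\<close>

lemma bi_young_eq_0_row:
  fixes F :: "nat list \<Rightarrow> nat list \<Rightarrow> 'a::field_char_0"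
  assumes IK: "I \<in> seqs d A" "K \<in> seqs d B"
    and pq: "p < B" "q < B" "p \<noteq> q" "fst (t p) = fst (t q)"
    and F: "\<And>I K. I \<in> seqs d A \<Longrightarrow> K \<in> seqs d B \<Longrightarrow> bi_act n id (transpose p q) F I K = - F I K"
  shows "bi_young n A B s t F I K = 0"
proof -
  {
    fix \<tau> \<sigma> \<tau>' \<sigma>'
    assume X: "\<tau> \<in> col_stab A s" "\<sigma> \<in> row_stab A s" "\<tau>' \<in> col_stab B t" "\<sigma>' \<in> row_stab B t"
    then have p: "\<tau> permutes {..<A}" "\<sigma> permutes {..<A}" "\<tau>' permutes {..<B}" "\<sigma>' permutes {..<B}"
      by (auto dest: stab_permutes)
    have tr: "transpose p q permutes {..<B}" using pq by (auto intro: permutes_swap_id)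
    have mem: "\<sigma>' \<circ> transpose p q \<in> row_stab B t" using X pq by (auto intro: stab_comp_transpose)
    have inv: "\<sigma>' \<circ> transpose p q \<circ> transpose p q = \<sigma>'" by (simp add: comp_assoc)
    have "bi_act n \<tau> (\<sigma>' \<circ> transpose p q) F I K = - bi_act n \<tau> \<sigma>' F I K" if "I \<in> seqs d A" "K \<in> seqs d B" for I K
    proof -
      have "bi_act n (\<tau> \<circ> id) (\<sigma>' \<circ> transpose p q) F I K = bi_act n \<tau> \<sigma>' (bi_act n id (transpose p q) F) I K"
        using that p tr by (subst bi_act_comp) (auto simp: seqs_def)
      also have "\<dots> = bi_act n \<tau> \<sigma>' (\<lambda>I K. - F I K) I K"
        by (rule bi_act_cong[OF p(1,4) that F])
      finally show ?thesis by (simp add: bi_act_def)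
    qed
    then have "bi_act n \<sigma> \<tau>' (bi_act n \<tau> (\<sigma>' \<circ> transpose p q) F) I K = bi_act n \<sigma> \<tau>' (\<lambda>I K. - bi_act n \<tau> \<sigma>' F I K) I K"
      by (rule bi_act_cong[OF p(2,3) IK])
    also have "\<dots> = - bi_act n \<sigma> \<tau>' (bi_act n \<tau> \<sigma>' F) I K"
      by (simp add: bi_act_def)
    finally have neg: "of_int (sign \<tau> * sign \<tau>') * bi_act n \<sigma> \<tau>' (bi_act n \<tau> (\<sigma>' \<circ> transpose p q) F) I K =
         - (of_int (sign \<tau> * sign \<tau>') * bi_act n \<sigma> \<tau>' (bi_act n \<tau> \<sigma>' F) I K)"
      by simp
    note mem inv neg
  } note key = this
  show ?thesis
    unfolding bi_young_def
  proof (rule sum_neg_involution[where T = "\<lambda>(\<tau>, \<sigma>, \<tau>', \<sigma>'). (\<tau>, \<sigma>, \<tau>', \<sigma>' \<circ> transpose p q)"], goal_cases)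
    case (1 x)
    then show ?case using key by auto
  next
    case (2 x)
    then show ?case using key by auto
  next
    case (3 x)
    then show ?case using key by (cases x rule: prod_cases4) (simp del: of_int_mult)
  qed
qed

text \<open>Conjugation turns a swap of original positions into the swap of their images, which the
  permutation acting afterwards can absorb.\<close>

lemma transpose_comp_permutes:
  assumes "\<tau> permutes S"
  shows "transpose (\<tau> p) (\<tau> q) \<circ> \<tau> = \<tau> \<circ> transpose p q"
  using permutes_inj[OF assms] by (auto simp: fun_eq_iff transpose_def dest: injD)

text \<open>The swap may depend on the two permutations that act first. It is absorbed on the right
  by those acting afterwards, \<open>\<sigma>\<close> and \<open>\<tau>'\<close>. The first two stay
  the same, hence so does the swap chosen for them, and the substitution is an involution.\<close>

lemma bi_young_eq_0_swap:
  fixes F :: "nat list \<Rightarrow> nat list \<Rightarrow> 'a::field_char_0"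
  assumes IK: "I \<in> seqs d A" "K \<in> seqs d B"
    and F: "\<And>\<tau> \<sigma>'. \<tau> \<in> col_stab A s \<Longrightarrow> \<sigma>' \<in> row_stab B t \<Longrightarrow>
       \<exists>p q p' q'. p < A \<and> q < A \<and> p' < B \<and> q' < B \<and> p \<noteq> q \<and> p' \<noteq> q' \<and>
         fst (s (\<tau> p)) = fst (s (\<tau> q)) \<and> snd (t (\<sigma>' p')) = snd (t (\<sigma>' q')) \<and>
         (\<forall>I\<in>seqs d A. \<forall>K\<in>seqs d B. bi_act n (transpose p q) (transpose p' q') F I K = F I K)"
  shows "bi_young n A B s t F I K = 0"
proof -
  have "\<forall>x. \<exists>p q p' q'. fst x \<in> col_stab A s \<longrightarrow> snd x \<in> row_stab B t \<longrightarrow>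
     (p < A \<and> q < A \<and> p' < B \<and> q' < B \<and> p \<noteq> q \<and> p' \<noteq> q' \<and>
         fst (s (fst x p)) = fst (s (fst x q)) \<and> snd (t (snd x p')) = snd (t (snd x q')) \<and>
         (\<forall>I\<in>seqs d A. \<forall>K\<in>seqs d B. bi_act n (transpose p q) (transpose p' q') F I K = F I K))"
    using F by blast
  then obtain p q p' q' where pq: "\<And>x. fst x \<in> col_stab A s \<Longrightarrow> snd x \<in> row_stab B t \<Longrightarrow>
     p x < A \<and> q x < A \<and> p' x < B \<and> q' x < B \<and> p x \<noteq> q x \<and> p' x \<noteq> q' x \<and>
         fst (s (fst x (p x))) = fst (s (fst x (q x))) \<and> snd (t (snd x (p' x))) = snd (t (snd x (q' x))) \<and>
         (\<forall>I\<in>seqs d A. \<forall>K\<in>seqs d B. bi_act n (transpose (p x) (q x)) (transpose (p' x) (q' x)) F I K = F I K)"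
    unfolding choice_iff by blast
  define \<rho> where "\<rho> \<tau> \<sigma>' = transpose (\<tau> (p (\<tau>, \<sigma>'))) (\<tau> (q (\<tau>, \<sigma>')))" for \<tau> \<sigma>' :: "nat \<Rightarrow> nat"
  define \<rho>' where "\<rho>' \<tau> \<sigma>' = transpose (\<sigma>' (p' (\<tau>, \<sigma>'))) (\<sigma>' (q' (\<tau>, \<sigma>')))" for \<tau> \<sigma>' :: "nat \<Rightarrow> nat"
  {
      fix \<tau> \<sigma> \<tau>' \<sigma>'
      assume X: "\<tau> \<in> col_stab A s" "\<sigma> \<in> row_stab A s" "\<tau>' \<in> col_stab B t" "\<sigma>' \<in> row_stab B t"
      then have p: "\<tau> permutes {..<A}" "\<sigma> permutes {..<A}" "\<tau>' permutes {..<B}" "\<sigma>' permutes {..<B}"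
        by (auto dest: stab_permutes)
      let ?p = "p (\<tau>, \<sigma>')" and ?q = "q (\<tau>, \<sigma>')" and ?p' = "p' (\<tau>, \<sigma>')" and ?q' = "q' (\<tau>, \<sigma>')"
      have x: "?p < A" "?q < A" "?p' < B" "?q' < B" "?p \<noteq> ?q" "?p' \<noteq> ?q'"
        "fst (s (\<tau> ?p)) = fst (s (\<tau> ?q))" "snd (t (\<sigma>' ?p')) = snd (t (\<sigma>' ?q'))"
        and fix_F: "\<And>I K. I \<in> seqs d A \<Longrightarrow> K \<in> seqs d B \<Longrightarrow>
           bi_act n (transpose ?p ?q) (transpose ?p' ?q') F I K = F I K"
        using pq[of "(\<tau>, \<sigma>')"] X by auto
      have im: "\<tau> ?p < A" "\<tau> ?q < A" "\<sigma>' ?p' < B" "\<sigma>' ?q' < B" "\<sigma>' ?p' \<noteq> \<sigma>' ?q'"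
        using p x permutes_inj[OF p(4)] by (auto simp: permutes_lessThan_less dest: injD)
      have tr: "transpose ?p ?q permutes {..<A}" "transpose ?p' ?q' permutes {..<B}"
        "\<rho> \<tau> \<sigma>' permutes {..<A}" "\<rho>' \<tau> \<sigma>' permutes {..<B}"
        unfolding \<rho>_def \<rho>'_def using im x by (auto intro: permutes_swap_id)
      have mem: "\<sigma> \<circ> \<rho> \<tau> \<sigma>' \<in> row_stab A s" "\<tau>' \<circ> \<rho>' \<tau> \<sigma>' \<in> col_stab B t"
        unfolding \<rho>_def \<rho>'_def using X im x by (auto intro: stab_comp_transpose)
      have inv: "\<sigma> \<circ> \<rho> \<tau> \<sigma>' \<circ> \<rho> \<tau> \<sigma>' = \<sigma>" "\<tau>' \<circ> \<rho>' \<tau> \<sigma>' \<circ> \<rho>' \<tau> \<sigma>' = \<tau>'"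
        by (simp_all add: \<rho>_def \<rho>'_def comp_assoc)
      have "bi_act n (\<rho> \<tau> \<sigma>') (\<rho>' \<tau> \<sigma>') (bi_act n \<tau> \<sigma>' F) I K = bi_act n \<tau> \<sigma>' F I K"
        if IK: "I \<in> seqs d A" "K \<in> seqs d B" for I K
      proof -
        have len: "length I = A" "length K = B" using IK by (auto simp: seqs_def)
        have "bi_act n (\<rho> \<tau> \<sigma>') (\<rho>' \<tau> \<sigma>') (bi_act n \<tau> \<sigma>' F) I K = bi_act n (\<rho> \<tau> \<sigma>' \<circ> \<tau>) (\<rho>' \<tau> \<sigma>' \<circ> \<sigma>') F I K"
          using len p tr by (subst bi_act_comp) auto
        also have "\<rho> \<tau> \<sigma>' \<circ> \<tau> = \<tau> \<circ> transpose ?p ?q"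
          unfolding \<rho>_def by (rule transpose_comp_permutes[OF p(1)])
        also have "\<rho>' \<tau> \<sigma>' \<circ> \<sigma>' = \<sigma>' \<circ> transpose ?p' ?q'"
          unfolding \<rho>'_def by (rule transpose_comp_permutes[OF p(4)])
        also have "bi_act n (\<tau> \<circ> transpose ?p ?q) (\<sigma>' \<circ> transpose ?p' ?q') F I K =
           bi_act n \<tau> \<sigma>' (bi_act n (transpose ?p ?q) (transpose ?p' ?q') F) I K"
          using len p tr by (subst bi_act_comp) auto
        also have "\<dots> = bi_act n \<tau> \<sigma>' F I K"
          by (rule bi_act_cong[OF p(1,4) IK fix_F])
        finally show ?thesis .
      qed
      then have "bi_act n \<sigma> \<tau>' (bi_act n (\<rho> \<tau> \<sigma>') (\<rho>' \<tau> \<sigma>') (bi_act n \<tau> \<sigma>' F)) I K = bi_act n \<sigma> \<tau>' (bi_act n \<tau> \<sigma>' F) I K"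
        by (rule bi_act_cong[OF p(2,3) IK])
      moreover have "bi_act n \<sigma> \<tau>' (bi_act n (\<rho> \<tau> \<sigma>') (\<rho>' \<tau> \<sigma>') (bi_act n \<tau> \<sigma>' F)) I K
         = bi_act n (\<sigma> \<circ> \<rho> \<tau> \<sigma>') (\<tau>' \<circ> \<rho>' \<tau> \<sigma>') (bi_act n \<tau> \<sigma>' F) I K"
        using IK p tr by (subst bi_act_comp) (auto simp: seqs_def)
      \<comment> \<open>Both outer permutations are multiplied by a transposition, but only the
        column permutation of \<open>t\<close> is weighted by its sign, so the net sign is
        -1.\<close>
      moreover have "sign (\<tau>' \<circ> \<rho>' \<tau> \<sigma>') = - sign \<tau>'"
        unfolding \<rho>'_def by (rule sign_comp_transpose[OF p(3) im(3,4,5)])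
      ultimately have neg: "of_int (sign \<tau> * sign (\<tau>' \<circ> \<rho>' \<tau> \<sigma>')) *
           bi_act n (\<sigma> \<circ> \<rho> \<tau> \<sigma>') (\<tau>' \<circ> \<rho>' \<tau> \<sigma>') (bi_act n \<tau> \<sigma>' F) I K =
         - (of_int (sign \<tau> * sign \<tau>') * bi_act n \<sigma> \<tau>' (bi_act n \<tau> \<sigma>' F) I K)"
        by simp
    note mem inv neg
  } note key = this
  show ?thesis
    unfolding bi_young_def
  proof (rule sum_neg_involution[where T = "\<lambda>(\<tau>, \<sigma>, \<tau>', \<sigma>'). (\<tau>, \<sigma> \<circ> \<rho> \<tau> \<sigma>', \<tau>' \<circ> \<rho>' \<tau> \<sigma>', \<sigma>')"], goal_cases)
    case (1 x)
    then show ?case using key by auto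
  next
    case (2 x)
    then show ?case using key by auto
  next
    case (3 x)
    then show ?case using key by (cases x rule: prod_cases4) (simp del: of_int_mult)
  qed
qed

section \<open>The dressed invariant\<close>

definition theta_coeff :: "nat \<Rightarrow> nat list \<Rightarrow> 'a::field" where
  "theta_coeff n L = (- 1) ^ (alphaL n L + parL n L)"

text \<open>The tensor \<open>v^*_I' \<otimes> \<theta>_N \<otimes> v_J'\<close>.\<close>

definition dressed_theta :: "nat \<Rightarrow> nat \<Rightarrow> nat list \<Rightarrow> nat list \<Rightarrow> nat list \<Rightarrow> nat list \<Rightarrow> 'a::field" where
  "dressed_theta n N I' J' = (\<lambda>I K. if take (length I') I = I' \<and> drop (length I') I = take N K \<and> drop N K = J'
     then theta_coeff n (drop (length I') I) else 0)"

lemma dressed_theta_append: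
  assumes "length I1 = length I'" "length L2 = N"
  shows "dressed_theta n N I' J' (I1 @ L1) (L2 @ J1) =
     (if I1 = I' \<and> L1 = L2 \<and> J1 = J' then theta_coeff n L1 else 0)"
  using assms by (auto simp: dressed_theta_def)

text \<open>The square of \<open>parL n L\<close> counts each pair of odd letters twice and each odd
  letter once. The consequence is that the coefficient of theta depends only on the number of odd
  letters and is unchanged by permutations.\<close>

lemma alphaL_eq: "alphaL n L + parL n L = parL n L * (parL n L + 1) div 2"
proof -
  let ?N = "length L" and ?p = "\<lambda>i. par n (L ! i)"
  have "parL n L * parL n L = (\<Sum>i<?N. \<Sum>j<?N. ?p i * ?p j)"
    by (simp add: parL_def sum_product)
  also have "\<dots> = (\<Sum>i<?N. \<Sum>j<?N. (if i < j then ?p i * ?p j else 0) +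
      (if j < i then ?p j * ?p i else 0) + (if i = j then ?p i else 0))"
    by (intro sum.cong) (auto simp: par_def)
  also have "\<dots> = alphaL n L + (\<Sum>i<?N. \<Sum>j<?N. if j < i then ?p j * ?p i else 0) + parL n L"
    by (simp add: sum.distrib alphaL_def parL_def)
  also have "(\<Sum>i<?N. \<Sum>j<?N. if j < i then ?p j * ?p i else 0) = alphaL n L"
    unfolding alphaL_def by (rule sum.swap)
  finally have "parL n L * (parL n L + 1) = 2 * (alphaL n L + parL n L)"
    by (simp add: algebra_simps)
  then show ?thesis by simp
qed

lemma theta_coeff_parL: "theta_coeff n L = (- 1) ^ (parL n L * (parL n L + 1) div 2)"
  by (simp add: theta_coeff_def alphaL_eq)

lemma theta_coeff_cong: "parL n L = parL n L' \<Longrightarrow> theta_coeff n L = theta_coeff n L'"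
  by (simp add: theta_coeff_parL)

text \<open>Going from k to k + 1 odd letters raises k(k+1)/2 by k + 1.\<close>

lemma theta_coeff_Suc:
  assumes "parL n L' = Suc (parL n L)"
  shows "theta_coeff n L' = (- 1) ^ Suc (parL n L) * (theta_coeff n L :: 'a::field)"
proof -
  have "Suc x * (Suc x + 1) div 2 = Suc x + x * (x + 1) div 2" for x :: nat
  proof -
    have "Suc x * (Suc x + 1) = x * (x + 1) + Suc x * 2" by simp
    then show ?thesis by (simp only: div_mult_self1[OF zero_neq_numeral[symmetric]])
  qed
  then show ?thesis by (simp add: theta_coeff_parL assms power_add)
qed

lemma sum_lessThan_add: "(\<Sum>k<p + q. f k) = (\<Sum>k<p. f k) + (\<Sum>k<q. f (p + k :: nat) :: 'a::comm_monoid_add)"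
  by (induction q) (auto simp: add_ac)

lemma parL_append: "parL n (L @ M) = parL n L + parL n M"
  by (simp add: parL_def sum_lessThan_add nth_append)

lemma parL_update:
  assumes "k < length L"
  shows "parL n (L[k := x]) + par n (L ! k) = parL n L + par n x"
proof -
  have "(\<Sum>i<length L. par n (L[k := x] ! i)) = par n x + (\<Sum>i\<in>{..<length L} - {k}. par n (L ! i))"
    using assms by (subst sum.remove[of _ k]) auto
  moreover have "(\<Sum>i<length L. par n (L ! i)) = par n (L ! k) + (\<Sum>i\<in>{..<length L} - {k}. par n (L ! i))"
    using assms by (subst sum.remove[of _ k]) auto
  ultimately show ?thesis by (simp add: parL_def)
qed

lemma parL_even: "(\<And>x. x \<in> set L \<Longrightarrow> x < n) \<Longrightarrow> parL n L = 0"
  by (simp add: parL_def par_def)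

lemma parL_odd: "(\<And>x. x \<in> set L \<Longrightarrow> \<not> x < n) \<Longrightarrow> parL n L = length L"
  by (simp add: parL_def par_def)

text \<open>One exponent for all cases: its first factor is odd only if the parity of the letter
  changes, and then the second is congruent mod 2 to the larger of the two numbers of odd
  letters.\<close>

lemma theta_coeff_update:
  assumes "k < length L"
  shows "theta_coeff n (L[k := b]) = (theta_coeff n L :: 'a::field) *
     (- 1) ^ ((par n (L ! k) + par n b) * (parL n L + 1 + par n (L ! k)))"
proof -
  have u: "parL n (L[k := b]) + par n (L ! k) = parL n L + par n b"
    using assms by (rule parL_update)
  consider "par n (L ! k) = par n b" | "par n (L ! k) = 0" "par n b = 1" | "par n (L ! k) = 1" "par n b = 0"
    using par_cases[of n b] par_cases[of n "L ! k"] by auto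
  then show ?thesis
  proof cases
    case 1
    then have "theta_coeff n (L[k := b]) = (theta_coeff n L :: 'a)"
      using u by (intro theta_coeff_cong) simp
    moreover have "even ((par n b + par n b) * (parL n L + 1 + par n b))" by simp
    ultimately show ?thesis unfolding 1 by (simp only: neg_one_even_power mult_1_right)
  next
    case 2
    then have "parL n (L[k := b]) = Suc (parL n L)" using u by simp
    from theta_coeff_Suc[OF this, where 'a = 'a] 2 show ?thesis by simp
  next
    case 3
    then have "parL n L = Suc (parL n (L[k := b]))" using u by simp
    then have "theta_coeff n L = (- 1) ^ parL n L * (theta_coeff n (L[k := b]) :: 'a)"
      by (metis theta_coeff_Suc)
    then have "theta_coeff n L * (- 1) ^ (parL n L + 2) =
        ((- 1) ^ (parL n L + 2) * (- 1) ^ parL n L) * (theta_coeff n (L[k := b]) :: 'a)"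
      by (simp only: mult_ac)
    also have "(- 1 :: 'a) ^ (parL n L + 2) * (- 1) ^ parL n L = 1"
      unfolding power_add[symmetric] by (rule neg_one_even_power) simp
    finally show ?thesis unfolding 3 by simp
  qed
qed

text \<open>On coefficients an elementary matrix rewrites the argument; this moves the rewriting to
  the sequence that the basis tensor prescribes.\<close>

lemma update_eq_iff:
  assumes "length L = length M" "k < length L"
  shows "L ! k = b \<and> L[k := a] = M \<longleftrightarrow> M ! k = a \<and> L = M[k := b]"
  using assms by (auto simp: list_update_beyond)

text \<open>The Leibniz sum splits into three segments. The letters of theta contribute zero, the
  k-th dual letter cancelling against the k-th letter on the other side. The letters of
  \<open>I0\<close> are even and leave no sign. Those of \<open>J0\<close> are odd, so
  \<open>k\<close> of them stand in front of position \<open>k\<close>, and \<open>b\<close> odd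
  turns the parity of the matrix into \<open>par n a + 1\<close>.\<close>

lemma actE_dressed_theta:
  fixes I K :: "nat list"
  assumes I0: "\<And>x. x \<in> set I0 \<Longrightarrow> x < n" and J0: "\<And>x. x \<in> set J0 \<Longrightarrow> \<not> x < n"
    and len: "length I = length I0 + N" "length K = N + length J0"
  shows "actE n a b (dressed_theta n N I0 J0) I K =
      - (\<Sum>k<length I0. if I0 ! k = a then dressed_theta n N (I0[k := b]) J0 I K else 0)
      + (\<Sum>k<length J0. if J0 ! k = b then (- 1) ^ ((par n a + 1) * k) * dressed_theta n N I0 (J0[k := a]) I K else (0::'a::field))"
proof -
  define I1 L1 L2 J1 where "I1 = take (length I0) I" "L1 = drop (length I0) I" "L2 = take N K" "J1 = drop N K"
  have IK: "I = I1 @ L1" "K = L2 @ J1"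
    and l: "length I1 = length I0" "length L1 = N" "length L2 = N" "length J1 = length J0"
    using len by (auto simp: I1_L1_L2_J1_def)
  let ?px = "par n a + par n b"
  let ?F = "dressed_theta n N I0 J0 :: nat list \<Rightarrow> nat list \<Rightarrow> 'a"
  let ?f = "\<lambda>k. if I ! k = b then (- 1) ^ ((par n b + par n a) * parL n (take k I)) * ?F (I[k := a]) K else 0"
  let ?g = "\<lambda>k. if K ! k = a then (- 1) ^ (?px * parL n (take k K)) * ?F I (K[k := b]) else 0"
  have par0: "parL n I0 = 0" using I0 by (rule parL_even)
  have pI0: "parL n (take k I0) = 0" for k
    by (rule parL_even) (use I0 in \<open>auto dest: in_set_takeD\<close>)
  have pJ0: "parL n (take k J0) = k" if "k < length J0" for k
    by (subst parL_odd) (use J0 that in \<open>auto dest: in_set_takeD\<close>)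
  have A: "- ((- 1) ^ (?px * par n a)) * (\<Sum>k<length I0. ?f k)
      = - (\<Sum>k<length I0. if I0 ! k = a then dressed_theta n N (I0[k := b]) J0 I K else 0)"
    unfolding sum_distrib_left sum_negf[symmetric]
  proof (rule sum.cong[OF refl])
    fix k assume "k \<in> {..<length I0}"
    then have k: "k < length I0" by simp
    let ?C = "I0 ! k = a \<and> I1 = I0[k := b] \<and> L1 = L2 \<and> J1 = J0"
    have C: "?C \<longleftrightarrow> I1 ! k = b \<and> I1[k := a] = I0 \<and> L1 = L2 \<and> J1 = J0"
      using update_eq_iff[of I1 I0 k b a] k l by auto
    have f: "?f k = (if ?C
       then (- 1) ^ ((par n b + par n a) * parL n (take k I1)) * theta_coeff n L1 else 0)"
      unfolding C using k l by (auto simp: IK nth_append list_update_append dressed_theta_append)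
    have dressed_theta: "(if I0 ! k = a then dressed_theta n N (I0[k := b]) J0 I K else 0) =
       (if ?C then theta_coeff n L1 else (0::'a))"
      using l by (simp add: IK dressed_theta_append)
    show "- ((- 1) ^ (?px * par n a)) * ?f k =
        - (if I0 ! k = a then dressed_theta n N (I0[k := b]) J0 I K else 0)"
    proof (cases ?C)
      case True
      then have "par n a = 0" "parL n (take k I1) = 0"
        using I0[of a] k pI0 by (auto simp: par_def)
      then show ?thesis unfolding f dressed_theta if_P[OF True] by simp
    next
      case False
      show ?thesis unfolding f dressed_theta if_not_P[OF False] by simp
    qed
  qed
  \<comment> \<open>The sign for passing the dual factor cancels the one for passing
    \<open>L2\<close>, since both have the same odd letters; the \<open>k\<close> odd letters of
    \<open>J0\<close> in front remain.\<close>
  have B: "(- 1) ^ (?px * parL n I) * (\<Sum>k<length J0. ?g (N + k)) =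
     (\<Sum>k<length J0. if J0 ! k = b then (- 1) ^ ((par n a + 1) * k) * dressed_theta n N I0 (J0[k := a]) I K else (0::'a))"
    unfolding sum_distrib_left
  proof (rule sum.cong[OF refl])
    fix k assume "k \<in> {..<length J0}"
    then have k: "k < length J0" by simp
    let ?C = "J0 ! k = b \<and> J1 = J0[k := a] \<and> I1 = I0 \<and> L1 = L2"
    have C: "?C \<longleftrightarrow> J1 ! k = a \<and> J1[k := b] = J0 \<and> I1 = I0 \<and> L1 = L2"
      using update_eq_iff[of J1 J0 k a b] k l by auto
    have g: "?g (N + k) = (if ?C
       then (- 1) ^ (?px * (parL n L2 + parL n (take k J1))) * theta_coeff n L1 else 0)"
      unfolding C using k l by (auto simp: IK nth_append list_update_append dressed_theta_append parL_append)
    have dressed_theta: "(if J0 ! k = b then (- 1) ^ ((par n a + 1) * k) * dressed_theta n N I0 (J0[k := a]) I K else 0) =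
       (if ?C then (- 1) ^ ((par n a + 1) * k) * theta_coeff n L1 else (0::'a))"
      using l by (simp add: IK dressed_theta_append)
    have sq: "(- 1 :: 'a) ^ (x * y) * ((- 1) ^ (x * (y + k)) * z) = (- 1) ^ (x * k) * z" for x y z
    proof -
      have "(- 1 :: 'a) ^ (x * y) * (- 1) ^ (x * (y + k)) = (- 1) ^ (2 * (x * y) + x * k)"
        unfolding power_add[symmetric] by (rule arg_cong[where f = "(^) _"]) (simp add: distrib_left)
      then show ?thesis by (simp add: power_add mult.assoc[symmetric])
    qed
    show "(- 1) ^ (?px * parL n I) * ?g (N + k) =
        (if J0 ! k = b then (- 1) ^ ((par n a + 1) * k) * dressed_theta n N I0 (J0[k := a]) I K else 0)"
    proof (cases ?C)
      case True
      then have "par n b = 1" "parL n (take k J1) = k" "parL n I = parL n L2"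
        using J0[of b] k pJ0 par0 by (auto simp: par_def IK parL_append)
      then show ?thesis unfolding g dressed_theta if_P[OF True] by (simp only: sq)
    next
      case False
      show ?thesis unfolding g dressed_theta if_not_P[OF False] by simp
    qed
  qed
  have C: "- ((- 1) ^ (?px * par n a)) * (\<Sum>k<N. ?f (length I0 + k)) +
      (- 1) ^ (?px * parL n I) * (\<Sum>k<N. ?g k) = 0"
    unfolding sum_distrib_left sum.distrib[symmetric]
  proof (rule sum.neutral, rule ballI)
    fix k assume "k \<in> {..<N}"
    then have k: "k < N" by simp
    let ?C = "L1 ! k = b \<and> L1[k := a] = L2 \<and> I1 = I0 \<and> J1 = J0"
    have C: "?C \<longleftrightarrow> L2 ! k = a \<and> L1 = L2[k := b] \<and> I1 = I0 \<and> J1 = J0"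
      using update_eq_iff[of L1 L2 k b a] k l by auto
    have f: "?f (length I0 + k) = (if ?C
       then (- 1) ^ ((par n b + par n a) * (parL n I1 + parL n (take k L1))) * theta_coeff n (L1[k := a]) else 0)"
      using k l by (auto simp: IK nth_append list_update_append dressed_theta_append parL_append)
    have g: "?g k = (if ?C
       then (- 1) ^ (?px * parL n (take k L2)) * theta_coeff n L1 else 0)"
      unfolding C using k l by (auto simp: IK nth_append list_update_append dressed_theta_append parL_append)
    show "- ((- 1) ^ (?px * par n a)) * ?f (length I0 + k) + (- 1) ^ (?px * parL n I) * ?g k = 0"
    proof (cases ?C)
      case True
      then have t: "take k L2 = take k L1" "L1 ! k = b" "parL n I1 = 0" using par0 by auto
      \<comment> \<open>The sign of the dual action and the change of the theta coefficient together
        differ from the sign for passing the dual factor by the exponent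
        \<open>?px * (?px + 1)\<close>, which is even.\<close>
      have "(- 1 :: 'a) ^ (?px * par n a) * (- 1) ^ (?px * (par n b + parL n L1 + 1)) = (- 1) ^ (?px * parL n L1)"
      proof -
        have ev: "even (?px * (?px + 1))" by simp
        have "?px * par n a + ?px * (par n b + parL n L1 + 1) = ?px * (?px + 1) + ?px * parL n L1"
          by (simp add: algebra_simps)
        then have "(- 1 :: 'a) ^ (?px * par n a) * (- 1) ^ (?px * (par n b + parL n L1 + 1)) =
            (- 1) ^ (?px * (?px + 1)) * (- 1) ^ (?px * parL n L1)"
          by (simp only: power_add[symmetric])
        then show ?thesis by (simp only: neg_one_even_power[OF ev] mult_1)
      qed
      moreover have "theta_coeff n (L1[k := a]) = (- 1 :: 'a) ^ (?px * (par n b + parL n L1 + 1)) * theta_coeff n L1"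
        using k l t(2) by (simp add: theta_coeff_update add_ac mult_ac)
      ultimately have "(- 1) ^ (?px * par n a) * theta_coeff n (L1[k := a]) = (- 1) ^ (?px * parL n L1) * (theta_coeff n L1 :: 'a)"
        by (simp add: mult.assoc[symmetric])
      moreover have "parL n I = parL n L1" using t by (simp add: IK parL_append)
      ultimately show ?thesis
        unfolding f g if_P[OF True] unfolding t by (simp add: add.commute mult_ac)
    next
      case False
      show ?thesis unfolding f g if_not_P[OF False] by simp
    qed
  qed
  have "actE n a b ?F I K =
      - ((- 1) ^ (?px * par n a)) * ((\<Sum>k<length I0. ?f k) + (\<Sum>k<N. ?f (length I0 + k))) +
      (- 1) ^ (?px * parL n I) * ((\<Sum>k<N. ?g k) + (\<Sum>k<length J0. ?g (N + k)))"
    unfolding actE_split len sum_lessThan_add by (rule refl)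
  moreover have "c * (x + x') + d * (y' + y) = p + q" if "c * x = p" "d * y = q" "c * x' + d * y' = 0"
    for c d p q x y x' y' :: 'a
  proof -
    have "c * (x + x') + d * (y' + y) = c * x + (c * x' + d * y') + d * y"
      by (simp add: distrib_left add_ac)
    with that show ?thesis by simp
  qed
  note this[OF A B C]
  ultimately show ?thesis by (rule trans)
qed

section \<open>The sequences \<open>I_h\<close> and \<open>J_h\<close> and the cells that their
  letters occupy\<close>

lemma nth_I_seq: "k < h * n \<Longrightarrow> I_seq n h ! k = k mod n"
proof (induction h arbitrary: k)
  case (Suc h)
  have "I_seq n (Suc h) = [0..<n] @ I_seq n h" by (simp add: I_seq_def)
  then show ?case
    using Suc by (cases "k < n") (auto simp: nth_append le_mod_geq)
qed simp

lemma length_I_seq: "length (I_seq n h) = h * n"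
  by (simp add: I_seq_def length_concat sum_list_replicate)

lemma length_J_seq: "length (J_seq n m h) = h * m"
  by (induction m) (auto simp: J_seq_def)

lemma nth_J_seq: "k < h * m \<Longrightarrow> J_seq n m h ! k = n + k div h"
proof (induction m)
  case (Suc m)
  have J: "J_seq n (Suc m) h = J_seq n m h @ replicate h (n + m)" by (simp add: J_seq_def)
  show ?case
  proof (cases "k < h * m")
    case True
    then show ?thesis using Suc by (simp add: J nth_append length_J_seq)
  next
    case False
    have "k div h = m"
      using False Suc.prems by (intro div_nat_eqI) (auto simp: mult.commute)
    with False Suc.prems show ?thesis by (simp add: J nth_append length_J_seq)
  qed
qed simp

text \<open>The occurrences of \<open>a\<close> in \<open>I_h\<close> are at
  \<open>i * n + a\<close>, which \<open>tab_s\<close> places in row \<open>a\<close> and column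
  \<open>i\<close>.\<close>

lemma sum_I_seq:
  assumes "a < n"
  shows "(\<Sum>k<h * n. if I_seq n h ! k = a then f k else 0) = (\<Sum>i<h. f (i * n + a) :: 'a::comm_monoid_add)"
proof -
  have "(\<Sum>k<h * n. if I_seq n h ! k = a then f k else 0) = (\<Sum>k\<in>{k. k < h * n \<and> k mod n = a}. f k)"
    by (rule sum.mono_neutral_cong_right) (auto simp: nth_I_seq)
  also have "\<dots> = (\<Sum>i<h. f (i * n + a))"
  proof (rule sum.reindex_bij_witness[of _ "\<lambda>i. i * n + a" "\<lambda>k. k div n"], goal_cases)
    case (4 i)
    then have "Suc i * n \<le> h * n" by (intro mult_le_mono1) simp
    then have "i * n + a < h * n" using assms by simp
    with assms show ?case by simp
  qed (use assms in \<open>auto simp: less_mult_imp_div_less\<close>)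
  finally show ?thesis .
qed

text \<open>The occurrences of \<open>n + b\<close> in \<open>J_h\<close> are at
  \<open>b * h + i\<close>, which \<open>tab_t\<close>, after the shift by \<open>n * m\<close>,
  places in row \<open>n + i\<close> and column \<open>b\<close>.\<close>

lemma sum_J_seq:
  assumes "b < m"
  shows "(\<Sum>k<h * m. if J_seq n m h ! k = n + b then f k else 0) = (\<Sum>i<h. f (b * h + i) :: 'a::comm_monoid_add)"
proof -
  have "(\<Sum>k<h * m. if J_seq n m h ! k = n + b then f k else 0) = (\<Sum>k\<in>{k. k < h * m \<and> k div h = b}. f k)"
    by (rule sum.mono_neutral_cong_right) (auto simp: nth_J_seq)
  also have "\<dots> = (\<Sum>i<h. f (b * h + i))"
  proof (rule sum.reindex_bij_witness[of _ "\<lambda>i. b * h + i" "\<lambda>k. k mod h"], goal_cases)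
    case (2 k)
    \<comment> \<open>\<open>k < h * m\<close> excludes \<open>h = 0\<close>, for which
      \<open>k mod h < h\<close> would fail.\<close>
    then have "h > 0" by (cases h) auto
    then show ?case by simp
  next
    case (4 i)
    then have "Suc b * h \<le> m * h" using assms by (intro mult_le_mono1) simp
    then have "b * h + i < h * m" using 4 by (simp add: mult.commute)
    with 4 show ?case by simp
  qed (use assms in \<open>auto simp: mult.commute\<close>)
  finally show ?thesis .
qed

lemma set_I_seq: "x \<in> set (I_seq n h) \<Longrightarrow> x < n"
  by (auto simp: I_seq_def split: if_splits)

lemma set_J_seq: "x \<in> set (J_seq n m h) \<Longrightarrow> \<not> x < n"
  by (auto simp: J_seq_def)

section \<open>Linking the two outer factors by one more contraction\<close>

lemma koszul_id [simp]: "koszul n id K = 1"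
  unfolding koszul_def by (rule prod.neutral) auto

lemma seq_act_id [simp]: "seq_act id K = K"
  by (simp add: seq_act_def map_nth)

lemma nth_seq_act_transpose:
  "k < length K \<Longrightarrow> seq_act (transpose p q) K ! k = K ! transpose p q k"
  by (simp add: nth_seq_act)

text \<open>Each letter in between is passed by two letters of the same parity, so these signs
  cancel and only the exchange of the two letters remains.\<close>

lemma koszul_transpose_eq:
  assumes "p \<noteq> q" "p < length K" "q < length K" "K ! p = K ! q"
  shows "koszul n (transpose p q) K = (- 1 :: 'a::field) ^ par n (K ! p)"
proof -
  have *: "koszul n (transpose p q) K = (- 1 :: 'a) ^ par n (K ! p)"
    if "p < q" "q < length K" "K ! p = K ! q" for p q
  proof -
    have "(- 1 :: 'a) ^ (e * e + (e + e) * x) = (- 1) ^ e" if "e = 0 \<or> e = 1" for e x :: nat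
      using that by (auto simp: power_add)
    then show ?thesis
      unfolding koszul_transpose[OF that(1,2)] that(3) using par_cases by blast
  qed
  show ?thesis
    using *[of p q] *[of q p] assms transpose_commute[of p q] by (cases "p < q") auto
qed

lemma seq_act_transpose_eq:
  assumes "p < length K" "q < length K" "K ! p = K ! q"
  shows "seq_act (transpose p q) K = K"
  by (rule nth_equalityI) (use assms in \<open>auto simp: nth_seq_act_transpose transpose_def\<close>)

text \<open>If the letters of \<open>I\<close> at \<open>p\<close> and \<open>q\<close> agree, the
  swap fixes \<open>I\<close> and leaves only the Koszul sign; if they differ, neither
  \<open>I\<close> nor the swapped sequence can match \<open>I'\<close>, and both sides
  vanish.\<close>

lemma bi_act_transpose_left:
  assumes "I \<in> seqs d A" "K \<in> seqs d B" "length I' \<le> A"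
    and "p < length I'" "q < length I'" "p \<noteq> q" "I' ! p = I' ! q"
  shows "bi_act n (transpose p q) id (dressed_theta n N I' J') I K = (- 1) ^ par n (I' ! p) * (dressed_theta n N I' J' I K :: 'a::field)"
proof (cases "I ! p = I ! q")
  case True
  have len: "length I = A" using assms by (simp add: seqs_def)
  have "bi_act n (transpose p q) id (dressed_theta n N I' J') I K = (- 1) ^ par n (I ! p) * (dressed_theta n N I' J' I K :: 'a)"
    using assms len True by (simp add: bi_act_def koszul_transpose_eq seq_act_transpose_eq)
  moreover have "I ! p = I' ! p" if "take (length I') I = I'"
    using that nth_take[OF assms(4), of I] by simp
  ultimately show ?thesis by (auto simp: dressed_theta_def)
next
  case False
  have len: "length I = A" using assms by (simp add: seqs_def)
  let ?I = "seq_act (transpose p q) I"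
  have sw: "?I ! p = I ! q" "?I ! q = I ! p" using assms len by (auto simp: nth_seq_act_transpose)
  have "take (length I') X \<noteq> I'" if "X ! p \<noteq> X ! q" for X
    using that assms(7) nth_take[OF assms(4), of X] nth_take[OF assms(5), of X] by auto
  then have "dressed_theta n N I' J' I K = (0::'a)" "dressed_theta n N I' J' ?I K = (0::'a)"
    using False sw by (auto simp: dressed_theta_def)
  then show ?thesis by (simp add: bi_act_def)
qed

lemma bi_act_transpose_right:
  assumes "I \<in> seqs d A" "K \<in> seqs d (N + length J')"
    and "p < length J'" "q < length J'" "p \<noteq> q" "J' ! p = J' ! q"
  shows "bi_act n id (transpose (N + p) (N + q)) (dressed_theta n N I' J') I K = (- 1) ^ par n (J' ! p) * (dressed_theta n N I' J' I K :: 'a::field)"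
proof (cases "K ! (N + p) = K ! (N + q)")
  case True
  have len: "length K = N + length J'" using assms by (simp add: seqs_def)
  have "bi_act n id (transpose (N + p) (N + q)) (dressed_theta n N I' J') I K = (- 1) ^ par n (K ! (N + p)) * (dressed_theta n N I' J' I K :: 'a)"
    using assms len True by (simp add: bi_act_def koszul_transpose_eq seq_act_transpose_eq)
  moreover have "K ! (N + p) = J' ! p" if "drop N K = J'"
    using that nth_drop[of N K p] len by simp
  ultimately show ?thesis by (auto simp: dressed_theta_def)
next
  case False
  have len: "length K = N + length J'" using assms by (simp add: seqs_def)
  let ?K = "seq_act (transpose (N + p) (N + q)) K"
  have sw: "?K ! (N + p) = K ! (N + q)" "?K ! (N + q) = K ! (N + p)" using assms len by (auto simp: nth_seq_act_transpose)
  have "drop N X \<noteq> J'" if "X ! (N + p) \<noteq> X ! (N + q)" "length X = length K" for X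
    using that assms(6) len nth_drop[of N X p] nth_drop[of N X q] by auto
  then have "dressed_theta n N I' J' I K = (0::'a)" "dressed_theta n N I' J' I ?K = (0::'a)"
    using False sw by (auto simp: dressed_theta_def)
  then show ?thesis by (simp add: bi_act_def)
qed

text \<open>The letters at position p of I0 and q of J0 are contracted with each other; the sign makes this
pair interchangeable with the pairs of \<open>\<theta>_N\<close>.\<close>

definition linked_theta :: "nat \<Rightarrow> nat \<Rightarrow> nat \<Rightarrow> nat list \<Rightarrow> nat list \<Rightarrow> nat \<Rightarrow> nat \<Rightarrow> nat list \<Rightarrow> nat list \<Rightarrow> 'a::field" where
  "linked_theta d n N I0 J0 p q = (\<lambda>I K. \<Sum>l<d. (- 1) ^ (par n l * (1 + q)) * dressed_theta n N (I0[p := l]) (J0[q := l]) I K)"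

text \<open>The pair j < N consists of the positions of the j-th letter of L; the pair j = N is the additional one.\<close>

definition pos_left :: "nat \<Rightarrow> nat \<Rightarrow> nat \<Rightarrow> nat \<Rightarrow> nat" where
  "pos_left N H p j = (if j < N then H + j else p)"

definition pos_right :: "nat \<Rightarrow> nat \<Rightarrow> nat \<Rightarrow> nat" where
  "pos_right N q j = (if j < N then j else N + q)"

text \<open>Only the last clause involves the \<open>N + 1\<close> pairs, and it treats them alike.
  The symmetry under exchange of two pairs shows in this form but not in
  \<open>linked_theta\<close>, where the additional pair is singled out.\<close>

definition linked_theta_supp :: "nat \<Rightarrow> nat list \<Rightarrow> nat list \<Rightarrow> nat \<Rightarrow> nat \<Rightarrow> nat list \<Rightarrow> nat list \<Rightarrow> bool" where
  "linked_theta_supp N I0 J0 p q I K \<longleftrightarrow> (\<forall>k<length I0. k \<noteq> p \<longrightarrow> I ! k = I0 ! k) \<and>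
     (\<forall>k<length J0. k \<noteq> q \<longrightarrow> K ! (N + k) = J0 ! k) \<and>
     (\<forall>j\<le>N. I ! pos_left N (length I0) p j = K ! pos_right N q j)"

lemma take_eq_iff_nth:
  "length M \<le> length I \<Longrightarrow> take (length M) I = M \<longleftrightarrow> (\<forall>k<length M. I ! k = M ! k)"
  by (subst list_eq_iff_nth_eq) simp

lemma drop_eq_iff_nth:
  "length K = N + length M \<Longrightarrow> drop N K = M \<longleftrightarrow> (\<forall>k<length M. K ! (N + k) = M ! k)"
  by (subst list_eq_iff_nth_eq) simp

lemma all_nth_list_update_iff:
  "i < length M \<Longrightarrow> (\<forall>k<length M. f k = M[i := l] ! k) \<longleftrightarrow>
     (\<forall>k<length M. k \<noteq> i \<longrightarrow> f k = M ! k) \<and> f i = l"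
  by (metis nth_list_update_eq nth_list_update_neq)

text \<open>For given \<open>I\<close> and \<open>K\<close> only the summand
  \<open>l = I ! p\<close> can be nonzero, so the sum over \<open>l\<close> collapses to a single
  signed coefficient.\<close>

lemma linked_theta_eq:
  assumes I: "I \<in> seqs d (length I0 + N)" and K: "K \<in> seqs d (N + length J0)"
    and p: "p < length I0" and q: "q < length J0"
  shows "linked_theta d n N I0 J0 p q I K = (if linked_theta_supp N I0 J0 p q I K
      then (- 1) ^ (par n (I ! p) * (1 + q)) * theta_coeff n (drop (length I0) I) else (0::'a::field))"
proof -
  have len: "length I = length I0 + N" "length K = N + length J0" using I K by (auto simp: seqs_def)
  have "I ! p \<in> set I" using len p by simp
  then have Ip: "I ! p < d" using I by (auto simp: seqs_def)
  have 1: "take (length I0) I = I0[p := l] \<longleftrightarrow> (\<forall>k<length I0. k \<noteq> p \<longrightarrow> I ! k = I0 ! k) \<and> I ! p = l" for l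
    using take_eq_iff_nth[of "I0[p := l]" I] all_nth_list_update_iff[OF p, of "(!) I" l] len(1)
    by (simp only: length_list_update le_add1 simp_thms)
  have 2: "drop N K = J0[q := l] \<longleftrightarrow> (\<forall>k<length J0. k \<noteq> q \<longrightarrow> K ! (N + k) = J0 ! k) \<and> K ! (N + q) = l" for l
    using drop_eq_iff_nth[of K N "J0[q := l]"] all_nth_list_update_iff[OF q, of "\<lambda>k. K ! (N + k)" l] len(2)
    by (simp only: length_list_update simp_thms)
  have 3: "drop (length I0) I = take N K \<longleftrightarrow> (\<forall>j<N. I ! (length I0 + j) = K ! j)"
    using drop_eq_iff_nth[of I "length I0" "take N K"] len by simp
  have 4: "(\<forall>j\<le>N. I ! pos_left N (length I0) p j = K ! pos_right N q j) \<longleftrightarrow>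
      (\<forall>j<N. I ! (length I0 + j) = K ! j) \<and> I ! p = K ! (N + q)"
    by (auto simp: pos_left_def pos_right_def le_less)
  have "dressed_theta n N (I0[p := l]) (J0[q := l]) I K =
      (if l = I ! p then if linked_theta_supp N I0 J0 p q I K then theta_coeff n (drop (length I0) I) else 0 else (0::'a))" for l
    unfolding dressed_theta_def linked_theta_supp_def length_list_update 1 2 3 4 by (cases "l = I ! p") (auto simp only: simp_thms if_True if_False split: if_split)
  then have "linked_theta d n N I0 J0 p q I K = (\<Sum>l<d. if l = I ! p then (- 1) ^ (par n l * (1 + q)) *
      (if linked_theta_supp N I0 J0 p q I K then theta_coeff n (drop (length I0) I) else (0::'a)) else 0)"
    unfolding linked_theta_def by (intro sum.cong) auto
  also have "\<dots> = (- 1) ^ (par n (I ! p) * (1 + q)) *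
      (if linked_theta_supp N I0 J0 p q I K then theta_coeff n (drop (length I0) I) else (0::'a))"
    using Ip by (subst sum.delta) auto
  finally show ?thesis by simp
qed

lemma transpose_of_inj:
  assumes "inj_on f S" "i \<in> S" "j \<in> S" "k \<in> S"
  shows "transpose (f i) (f j) (f k) = f (transpose i j k)"
  using assms by (auto simp: transpose_def dest: inj_onD)

text \<open>Both swaps act on the pairs through the same transposition of the indices
  \<open>j1\<close> and \<open>j2\<close>, so they merely permute the conditions of the last
  clause.\<close>

lemma linked_theta_supp_swap:
  assumes len: "length I = length I0 + N" "length K = N + length J0"
    and pq: "p < length I0" "q < length J0" and j: "j1 \<le> N" "j2 \<le> N"
  shows "linked_theta_supp N I0 J0 p q
      (seq_act (transpose (pos_left N (length I0) p j1) (pos_left N (length I0) p j2)) I)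
      (seq_act (transpose (pos_right N q j1) (pos_right N q j2)) K) \<longleftrightarrow> linked_theta_supp N I0 J0 p q I K"
proof -
  let ?P = "pos_left N (length I0) p" and ?Q = "pos_right N q"
  let ?I = "seq_act (transpose (?P j1) (?P j2)) I" and ?K = "seq_act (transpose (?Q j1) (?Q j2)) K"
  have inj: "inj_on ?P {..N}" "inj_on ?Q {..N}"
    using pq by (auto simp: inj_on_def pos_left_def pos_right_def)
  have lt: "?P j < length I" "?Q j < length K" if "j \<le> N" for j
    using that pq len by (auto simp: pos_left_def pos_right_def)
  have a: "?I ! k = I ! k" if "k < length I0" "k \<noteq> p" for k
    using that len by (auto simp: nth_seq_act_transpose transpose_def pos_left_def)
  have b: "?K ! (N + k) = K ! (N + k)" if "k < length J0" "k \<noteq> q" for k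
    using that len by (auto simp: nth_seq_act_transpose transpose_def pos_right_def)
  have c: "?I ! ?P j = I ! ?P (transpose j1 j2 j)" "?K ! ?Q j = K ! ?Q (transpose j1 j2 j)" if "j \<le> N" for j
    using that j lt transpose_of_inj[OF inj(1), of j1 j2 j] transpose_of_inj[OF inj(2), of j1 j2 j]
    by (simp_all add: nth_seq_act_transpose)
  have tr: "transpose j1 j2 k \<le> N" if "k \<le> N" for k using that j by (auto simp: transpose_def)
  have "(\<forall>j\<le>N. ?I ! ?P j = ?K ! ?Q j) \<longleftrightarrow> (\<forall>j\<le>N. I ! ?P (transpose j1 j2 j) = K ! ?Q (transpose j1 j2 j))"
    by (simp add: c)
  also have "\<dots> \<longleftrightarrow> (\<forall>j\<le>N. I ! ?P j = K ! ?Q j)" (is "?l \<longleftrightarrow> ?r")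
  proof
    assume l: ?l
    show ?r
    proof (intro allI impI)
      fix j assume "j \<le> N"
      from l[rule_format, OF tr[OF this]] show "I ! ?P j = K ! ?Q j" by simp
    qed
  qed (use tr in blast)
  finally show ?thesis
    unfolding linked_theta_supp_def by (simp add: a b cong: conj_cong)
qed

lemma parL_drop: "H \<le> length I \<Longrightarrow> parL n (drop H I) = (\<Sum>j<length I - H. par n (I ! (H + j)))"
  by (simp add: parL_def)

text \<open>The prefix is even except possibly at \<open>p\<close>. With this the parity of the
  whole sequence splits into that of \<open>I ! p\<close> and that of the theta part.\<close>

lemma parL_take_supp:
  assumes "\<And>x. x \<in> set I0 \<Longrightarrow> x < n" "p < length I0" "length I0 \<le> length I"
    and "\<And>k. k < length I0 \<Longrightarrow> k \<noteq> p \<Longrightarrow> I ! k = I0 ! k"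
  shows "parL n (take (length I0) I) = par n (I ! p)"
proof -
  have "parL n (take (length I0) I) = (\<Sum>k<length I0. par n (I ! k))"
    using assms(3) by (simp add: parL_def min_def)
  also have "\<dots> = par n (I ! p) + (\<Sum>k\<in>{..<length I0} - {p}. par n (I ! k))"
    using assms(2) by (subst sum.remove[of _ p]) auto
  also have "(\<Sum>k\<in>{..<length I0} - {p}. par n (I ! k)) = 0"
    using assms by (auto simp: par_def)
  finally show ?thesis by simp
qed

text \<open>Two pairs of theta pass the same letters in both factors, so their Koszul signs cancel.
  If the additional pair takes part, the odd letters passed on the two sides are those of the rest
  of the theta part and the \<open>q\<close> letters of \<open>J0\<close> in front of position
  \<open>q\<close>; their sign, the change of the theta coefficient and the weight with exponent
  \<open>1 + q\<close> balance.\<close>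

lemma linked_theta_swap:
  assumes I0: "\<And>x. x \<in> set I0 \<Longrightarrow> x < n" and J0: "\<And>x. x \<in> set J0 \<Longrightarrow> \<not> x < n"
    and I: "I \<in> seqs d (length I0 + N)" and K: "K \<in> seqs d (N + length J0)"
    and pq: "p < length I0" "q < length J0" and j: "j1 < j2" "j2 \<le> N"
  shows "bi_act n (transpose (pos_left N (length I0) p j1) (pos_left N (length I0) p j2))
      (transpose (pos_right N q j1) (pos_right N q j2)) (linked_theta d n N I0 J0 p q) I K
    = (linked_theta d n N I0 J0 p q I K :: 'a::field)"
proof -
  let ?H = "length I0"
  let ?P = "pos_left N ?H p" and ?Q = "pos_right N q"
  let ?\<rho> = "transpose (?P j1) (?P j2)" and ?\<rho>' = "transpose (?Q j1) (?Q j2)"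
  let ?I = "seq_act ?\<rho> I" and ?K = "seq_act ?\<rho>' K"
  have len: "length I = ?H + N" "length K = N + length J0" using I K by (auto simp: seqs_def)
  have lt: "?P j < length I" "?Q j < length K" if "j \<le> N" for j
    using that pq len by (auto simp: pos_left_def pos_right_def)
  have perm: "?\<rho> permutes {..<?H + N}" "?\<rho>' permutes {..<N + length J0}"
    using lt[of j1] lt[of j2] j len by (auto intro!: permutes_swap_id)
  have supp: "linked_theta_supp N I0 J0 p q ?I ?K \<longleftrightarrow> linked_theta_supp N I0 J0 p q I K"
    using len pq j by (intro linked_theta_supp_swap) auto
  have bi_act: "bi_act n ?\<rho> ?\<rho>' (linked_theta d n N I0 J0 p q) I K = koszul n ?\<rho> I * koszul n ?\<rho>' K * linked_theta d n N I0 J0 p q ?I ?K"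
    by (simp add: bi_act_def)
  have seqs: "?I \<in> seqs d (?H + N)" "?K \<in> seqs d (N + length J0)"
    using seq_act_in_seqs[OF perm(1) I] seq_act_in_seqs[OF perm(2) K] .
  show ?thesis
  proof (cases "linked_theta_supp N I0 J0 p q I K")
    case False
    then show ?thesis
      unfolding bi_act linked_theta_eq[OF seqs pq] linked_theta_eq[OF I K pq] supp by simp
  next
    case True
    then have IK: "I ! ?P j = K ! ?Q j" if "j \<le> N" for j
      using that by (auto simp: linked_theta_supp_def)
    have J: "K ! (N + k) = J0 ! k" if "k < length J0" "k \<noteq> q" for k
      using that True by (auto simp: linked_theta_supp_def)
    \<comment> \<open>The total parity \<open>x\<close> is preserved by a permutation, so the swap
      can only move parity between position \<open>p\<close> and the theta part.\<close>
    define x L L' where "x = parL n I" and "L = drop ?H I" and "L' = drop ?H ?I"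
    have "parL n (take ?H I) = par n (I ! p)"
      using I0 pq len True by (intro parL_take_supp) (auto simp: linked_theta_supp_def)
    then have L: "par n (I ! p) + parL n L = x"
      unfolding x_def L_def by (metis append_take_drop_id parL_append)
    have "parL n (take ?H ?I) = par n (?I ! p)"
      using I0 pq len True[folded supp] by (intro parL_take_supp) (auto simp: linked_theta_supp_def)
    then have L': "par n (?I ! p) + parL n L' = x"
      unfolding x_def L'_def using perm len by (metis append_take_drop_id parL_append parL_seq_act)
    have goal: "koszul n ?\<rho> I * koszul n ?\<rho>' K * ((- 1) ^ (par n (?I ! p) * (1 + q)) * theta_coeff n L') =
        (- 1) ^ (par n (I ! p) * (1 + q)) * (theta_coeff n L :: 'a)"
    proof (cases "j2 < N")
      case True
      have "?I ! p = I ! p"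
        using pq len True j by (auto simp: nth_seq_act_transpose transpose_def pos_left_def)
      moreover from this have "theta_coeff n L' = (theta_coeff n L :: 'a)"
        using L L' by (intro theta_coeff_cong) simp
      moreover have "koszul n ?\<rho> I * koszul n ?\<rho>' K = (1::'a)"
      proof -
        have at: "I ! (?H + j) = K ! j" if "j < N" for j
          using that IK[of j] by (simp add: pos_left_def pos_right_def)
        have at': "K ! (j - ?H) = I ! j" if "?H < j" "j < ?H + N" for j
          using that at[of "j - ?H"] by simp
        have "(\<Sum>j\<in>{?H + j1<..<?H + j2}. par n (I ! j)) = (\<Sum>j\<in>{j1<..<j2}. par n (K ! j))"
          by (rule sum.reindex_bij_witness[of _ "\<lambda>j. ?H + j" "\<lambda>j. j - ?H"])
             (use at' True in auto)
        then have "koszul n ?\<rho> I = (koszul n ?\<rho>' K :: 'a)"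
          using True j len at by (simp add: pos_left_def pos_right_def koszul_transpose)
        then show ?thesis by (simp add: koszul_square)
      qed
      ultimately show ?thesis by simp
    next
      case False
      then have j2: "j2 = N" using j by simp
      then have j1: "j1 < N" using j by simp
      have P: "?P j1 = ?H + j1" "?P j2 = p" "?Q j1 = j1" "?Q j2 = N + q"
        using j1 j2 by (auto simp: pos_left_def pos_right_def)
      let ?x = "par n (I ! p)" and ?y = "par n (I ! (?H + j1))"
      have y: "?I ! p = I ! (?H + j1)"
        using pq len by (simp add: nth_seq_act_transpose P)
      have at: "I ! (?H + j) = K ! j" if "j < N" for j
        using that IK[of j] by (simp add: pos_left_def pos_right_def)
      have atp: "I ! p = K ! (N + q)"
        using IK[of N] by (simp add: pos_left_def pos_right_def)
      \<comment> \<open>On the dual side the letters passed are even letters of \<open>I0\<close>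
        and the theta part before \<open>j1\<close>; on the other side they are the theta part after
        \<open>j1\<close> and \<open>q\<close> odd letters of \<open>J0\<close>.\<close>
      let ?S1 = "\<Sum>j\<in>{p<..<?H + j1}. par n (I ! j)" and ?S2 = "\<Sum>j\<in>{j1<..<N + q}. par n (K ! j)"
      have "?S1 = (\<Sum>j\<in>{?H..<?H + j1}. par n (I ! j))"
      proof (rule sum.mono_neutral_right)
        show "\<forall>i\<in>{p<..<?H + j1} - {?H..<?H + j1}. par n (I ! i) = 0"
          using \<open>linked_theta_supp N I0 J0 p q I K\<close> I0 by (auto simp: linked_theta_supp_def par_def)
      qed (use pq in auto)
      also have "\<dots> = (\<Sum>j<j1. par n (I ! (?H + j)))"
        by (rule sum.reindex_bij_witness[of _ "\<lambda>j. ?H + j" "\<lambda>j. j - ?H"]) auto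
      finally have S1: "?S1 = (\<Sum>j<j1. par n (I ! (?H + j)))" .
      have "?S2 = (\<Sum>j\<in>{j1<..<N}. par n (K ! j)) + (\<Sum>j\<in>{N..<N + q}. par n (K ! j))"
        using j1 by (subst sum.union_disjoint[symmetric]) (auto intro!: sum.cong)
      also have "(\<Sum>j\<in>{j1<..<N}. par n (K ! j)) = (\<Sum>j\<in>{j1<..<N}. par n (I ! (?H + j)))"
        using at by (intro sum.cong) auto
      also have "(\<Sum>j\<in>{N..<N + q}. par n (K ! j)) = (\<Sum>j\<in>{N..<N + q}. 1)"
      proof (rule sum.cong[OF refl])
        fix i assume "i \<in> {N..<N + q}"
        then obtain k where k: "i = N + k" "k < q" by (auto simp: le_iff_add)
        with J[of k] pq J0[of "J0 ! k"] show "par n (K ! i) = 1" by (simp add: par_def)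
      qed
      finally have S2: "?S2 = (\<Sum>j\<in>{j1<..<N}. par n (I ! (?H + j))) + q" by simp
      have "parL n L = (\<Sum>j<N. par n (I ! (?H + j)))"
        using len by (simp add: L_def parL_drop)
      also have "{..<N} = insert j1 ({..<j1} \<union> {j1<..<N})" using j1 by auto
      also have "(\<Sum>j\<in>\<dots>. par n (I ! (?H + j))) = ?y + (\<Sum>j<j1. par n (I ! (?H + j)))
          + (\<Sum>j\<in>{j1<..<N}. par n (I ! (?H + j)))"
        by (subst sum.insert) (auto intro!: sum.union_disjoint simp: add.assoc)
      finally have S: "?S1 + ?S2 + ?y = parL n L + q" using S1 S2 by simp
      have k1: "koszul n ?\<rho> I = (- 1 :: 'a) ^ (?x * ?y + (?x + ?y) * ?S1)"
        unfolding P transpose_commute[of "?H + j1" p] using pq j1 len by (subst koszul_transpose) auto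
      have k2: "koszul n ?\<rho>' K = (- 1 :: 'a) ^ (?y * ?x + (?y + ?x) * ?S2)"
        unfolding P atp at[OF j1] using pq j1 len by (subst koszul_transpose) auto
      \<comment> \<open>The two letters pass each other once on each side, so their mutual exchange
        contributes an even exponent.\<close>
      have "koszul n ?\<rho> I * koszul n ?\<rho>' K = (- 1 :: 'a) ^ (2 * (?x * ?y) + (?x + ?y) * (?S1 + ?S2))"
        unfolding k1 k2 power_add[symmetric]
        by (rule arg_cong[where f = "(^) _"]) (simp add: algebra_simps)
      then have k: "koszul n ?\<rho> I * koszul n ?\<rho>' K = (- 1 :: 'a) ^ ((?x + ?y) * (?S1 + ?S2))"
        by (simp add: power_add)
      consider "?x = ?y" | "?x = 0" "?y = 1" | "?x = 1" "?y = 0"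
        using par_cases[of n "I ! p"] par_cases[of n "I ! (?H + j1)"] by auto
      then show ?thesis
      proof cases
        case 1
        then have "theta_coeff n L' = (theta_coeff n L :: 'a)"
          using L L' y by (intro theta_coeff_cong) simp
        moreover have "even ((?y + ?y) * (?S1 + ?S2))" by simp
        ultimately show ?thesis
          unfolding k y 1 by (simp only: neg_one_even_power mult_1)
      next
        case 2
        then have "parL n L = Suc (parL n L')" using L L' y by simp
        from theta_coeff_Suc[OF this, where 'a = 'a]
        have t: "theta_coeff n L = (- 1) ^ parL n L * (theta_coeff n L' :: 'a)"
          using \<open>parL n L = Suc (parL n L')\<close> by simp
        have e: "(?x + ?y) * (?S1 + ?S2) + ?y * (1 + q) = parL n L + 2 * q"
          using 2 S by simp
        show ?thesis
          unfolding k y mult.assoc[symmetric] power_add[symmetric] e t unfolding 2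
          by (simp add: power_add)
      next
        case 3
        then have "parL n L' = Suc (parL n L)" using L L' y by simp
        from theta_coeff_Suc[OF this, where 'a = 'a]
        have t: "theta_coeff n L' = (- 1) ^ Suc (parL n L) * (theta_coeff n L :: 'a)" .
        have k3: "koszul n ?\<rho> I * koszul n ?\<rho>' K = (- 1 :: 'a) ^ (parL n L + q)"
          using k 3 S by simp
        have "parL n L + q + Suc (parL n L) = 2 * parL n L + (1 + q)" by simp
        then have "(- 1 :: 'a) ^ (parL n L + q) * (- 1) ^ Suc (parL n L) = (- 1) ^ (2 * parL n L) * (- 1) ^ (1 + q)"
          by (simp only: power_add[symmetric])
        then show ?thesis
          unfolding k3 y t 3 by (simp add: mult.assoc[symmetric])
      qed
    qed
    show ?thesis
      unfolding bi_act linked_theta_eq[OF seqs pq] linked_theta_eq[OF I K pq] supp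
      using True goal by (simp add: L_def L'_def)
  qed
qed

section \<open>Invariance of the element\<close>

definition sym_theta :: "nat \<Rightarrow> nat \<Rightarrow> nat \<Rightarrow> nat list \<Rightarrow> nat list \<Rightarrow> nat list \<Rightarrow> nat list \<Rightarrow> 'a::field" where
  "sym_theta n m h I' J' = bi_young n ((m + h) * n) ((n + h) * m) (tab_s n m h) (tab_t n m h) (dressed_theta n (n * m) I' J')"

text \<open>By linearity the symmetrizers move outside the sum over L; a given pair of arguments
  then sees only the summand whose L is the tail of \<open>I\<close>.\<close>

lemma the_element_eq:
  assumes I: "I \<in> seqs (n + m) ((m + h) * n)" and K: "K \<in> seqs (n + m) ((n + h) * m)"
  shows "the_element n m h I K = (sym_theta n m h (I_seq n h) (J_seq n m h) I K :: 'a::field)"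
proof -
  let ?A = "(m + h) * n" and ?B = "(n + h) * m" and ?I0 = "I_seq n h" and ?J0 = "J_seq n m h"
  let ?S = "seqs (n + m) (n * m)"
  let ?Y = "bi_young n ?A ?B (tab_s n m h) (tab_t n m h)"
  have fin: "finite ?S" unfolding seqs_def using finite_lists_length_eq[of "{..<n + m}" "n * m"]
    by (simp add: conj_commute)
  have "the_element n m h I K = (\<Sum>L\<in>?S. theta_coeff n L *
      ?Y (\<lambda>I K. basis_vec (?I0 @ L) I * basis_vec (L @ ?J0) K :: 'a) I K)"
    unfolding the_element_def mult.assoc
    using I K by (subst bi_young_tensor) (auto simp: seqs_def theta_coeff_def)
  also have "\<dots> = ?Y (\<lambda>I K. \<Sum>L\<in>?S. theta_coeff n L * (basis_vec (?I0 @ L) I * basis_vec (L @ ?J0) K)) I K"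
    by (rule bi_young_sum[symmetric])
  also have "\<dots> = ?Y (dressed_theta n (n * m) ?I0 ?J0) I K"
  proof (rule bi_young_cong[OF I K])
    fix I K assume I: "I \<in> seqs (n + m) ?A" and K: "K \<in> seqs (n + m) ?B"
    let ?L = "drop (h * n) I"
    have len: "length I = h * n + n * m" "length K = n * m + h * m"
      using I K by (auto simp: seqs_def algebra_simps)
    have L: "?L \<in> ?S" using I len by (auto simp: seqs_def dest: in_set_dropD)
    have eq: "I = ?I0 @ L \<and> K = L @ ?J0 \<longleftrightarrow> L = ?L \<and> take (h * n) I = ?I0 \<and> ?L = take (n * m) K \<and> drop (n * m) K = ?J0"
      if "L \<in> ?S" for L
      using that len append_take_drop_id[of "h * n" I] append_take_drop_id[of "n * m" K]
      by (auto simp: seqs_def length_I_seq simp del: append_take_drop_id)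
    have "(\<Sum>L\<in>?S. theta_coeff n L * (basis_vec (?I0 @ L) I * basis_vec (L @ ?J0) K)) =
       (\<Sum>L\<in>?S. if L = ?L then dressed_theta n (n * m) ?I0 ?J0 I K else (0::'a))"
    proof (rule sum.cong[OF refl])
      fix L assume "L \<in> ?S"
      from eq[OF this] show "theta_coeff n L * (basis_vec (?I0 @ L) I * basis_vec (L @ ?J0) K) =
         (if L = ?L then dressed_theta n (n * m) ?I0 ?J0 I K else (0::'a))"
        unfolding basis_vec_def dressed_theta_def length_I_seq by (cases "I = ?I0 @ L \<and> K = L @ ?J0") (auto simp only: if_True if_False simp_thms mult_zero_right mult_1_right mult_zero_left split: if_split)
    qed
    also have "\<dots> = dressed_theta n (n * m) ?I0 ?J0 I K"
      using fin L by simp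
    finally show "(\<Sum>L\<in>?S. theta_coeff n L * (basis_vec (?I0 @ L) I * basis_vec (L @ ?J0) K)) =
       (dressed_theta n (n * m) ?I0 ?J0 I K :: 'a)" .
  qed
  finally show ?thesis by (simp add: sym_theta_def)
qed

lemma pos_less:
  assumes "i < (h::nat)" "a < n"
  shows "i * n + a < h * n"
proof -
  have "Suc i * n \<le> h * n" using assms by (intro mult_le_mono1) simp
  then show ?thesis using assms by simp
qed

text \<open>Column \<open>i\<close> of \<open>s\<close> already holds \<open>l\<close>, in row
  \<open>l\<close>. The new letter is a second copy, and swapping two equal even letters fixes the
  tensor.\<close>

lemma sym_theta_eq_0_col:
  assumes IK: "I \<in> seqs (n + m) ((m + h) * n)" "K \<in> seqs (n + m) ((n + h) * m)"
    and "i < h" "a < n" "l < n" "l \<noteq> a"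
  shows "sym_theta n m h ((I_seq n h)[i * n + a := l]) J' I K = (0::'a::field_char_0)"
proof -
  let ?p = "i * n + a" and ?q = "i * n + l" and ?I = "(I_seq n h)[i * n + a := l]"
  have pq: "?p < h * n" "?q < h * n" using assms pos_less by auto
  have A: "(m + h) * n = h * n + m * n" by (simp add: algebra_simps)
  have I: "?I ! ?p = l" "?I ! ?q = l"
    using assms pq by (auto simp: nth_list_update length_I_seq nth_I_seq)
  show ?thesis
    unfolding sym_theta_def
  proof (rule bi_young_eq_0_col[OF IK, of ?p ?q])
    show "snd (tab_s n m h ?p) = snd (tab_s n m h ?q)"
      using assms pq by (simp add: tab_s_def)
    fix I K assume IK: "I \<in> seqs (n + m) ((m + h) * n)" "K \<in> seqs (n + m) ((n + h) * m)"
    have "bi_act n (transpose ?p ?q) id (dressed_theta n (n * m) ?I J') I K = (- 1) ^ par n (?I ! ?p) * (dressed_theta n (n * m) ?I J' I K :: 'a)"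
      by (rule bi_act_transpose_left[OF IK]) (use pq I assms A in \<open>auto simp: length_I_seq\<close>)
    then show "bi_act n (transpose ?p ?q) id (dressed_theta n (n * m) ?I J') I K = (dressed_theta n (n * m) ?I J' I K :: 'a)"
      using I assms by (simp add: par_def)
  qed (use pq A assms in auto)
qed

text \<open>Row \<open>n + i\<close> of \<open>t\<close> already holds the letter
  \<open>n + l\<close>, in column \<open>l\<close>. The new letter is a second copy, and swapping
  two equal odd letters changes the sign of the tensor.\<close>

lemma sym_theta_eq_0_row:
  assumes IK: "I \<in> seqs (n + m) ((m + h) * n)" "K \<in> seqs (n + m) ((n + h) * m)"
    and "i < h" "b < m" "l < m" "l \<noteq> b"
  shows "sym_theta n m h I' ((J_seq n m h)[b * h + i := n + l]) I K = (0::'a::field_char_0)"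
proof -
  let ?p = "b * h + i" and ?q = "l * h + i" and ?J = "(J_seq n m h)[b * h + i := n + l]"
  have pq: "?p < h * m" "?q < h * m" using assms pos_less[of b m i h] pos_less[of l m i h] by (auto simp: mult.commute)
  have B: "(n + h) * m = n * m + h * m" by (simp add: algebra_simps)
  have ne: "?p \<noteq> ?q" using assms by auto
  have J: "?J ! ?p = n + l" "?J ! ?q = n + l"
    using assms pq by (auto simp: nth_list_update length_J_seq nth_J_seq)
  show ?thesis
    unfolding sym_theta_def
  proof (rule bi_young_eq_0_row[OF IK, of "n * m + ?p" "n * m + ?q"])
    show "fst (tab_t n m h (n * m + ?p)) = fst (tab_t n m h (n * m + ?q))"
      using assms by (simp add: tab_t_def)
    fix I K assume IK: "I \<in> seqs (n + m) ((m + h) * n)" "K \<in> seqs (n + m) ((n + h) * m)"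
    have "bi_act n id (transpose (n * m + ?p) (n * m + ?q)) (dressed_theta n (n * m) I' ?J) I K = (- 1) ^ par n (?J ! ?p) * (dressed_theta n (n * m) I' ?J I K :: 'a)"
      by (rule bi_act_transpose_right[OF IK(1)]) (use IK(2) pq J ne B in \<open>auto simp: length_J_seq\<close>)
    then show "bi_act n id (transpose (n * m + ?p) (n * m + ?q)) (dressed_theta n (n * m) I' ?J) I K = - (dressed_theta n (n * m) I' ?J I K :: 'a)"
      using J by (simp add: par_def)
  qed (use pq B ne in auto)
qed

lemma fst_tab_s_less: "0 < n \<Longrightarrow> fst (tab_s n m h k) < n"
  by (simp add: tab_s_def)

lemma snd_tab_t_less:
  assumes "k < (n + h) * m"
  shows "snd (tab_t n m h k) < m"
  using assms by (auto simp: tab_t_def algebra_simps intro!: less_mult_imp_div_less)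

text \<open>This is the one relation that couples a change in \<open>I_h\<close> with a change in
  \<open>J_h\<close>; the two preceding vanishing lemmas use a swap in a single factor.\<close>

lemma sym_theta_linked_theta:
  assumes IK: "I \<in> seqs (n + m) ((m + h) * n)" "K \<in> seqs (n + m) ((n + h) * m)"
    and i: "i < h" and a: "a < n" and b: "b < m"
  shows "(\<Sum>l<n + m. (- 1) ^ (par n l * (1 + (b * h + i))) *
      sym_theta n m h ((I_seq n h)[i * n + a := l]) ((J_seq n m h)[b * h + i := l]) I K) = (0::'a::field_char_0)"
proof -
  let ?I0 = "I_seq n h" and ?J0 = "J_seq n m h" and ?p = "i * n + a" and ?q = "b * h + i"
  let ?N = "n * m"
  let ?P = "pos_left ?N (h * n) ?p" and ?Q = "pos_right ?N ?q"
  have A: "(m + h) * n = length ?I0 + ?N" and B: "(n + h) * m = ?N + length ?J0"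
    by (simp_all add: algebra_simps length_I_seq length_J_seq)
  have pq: "?p < length ?I0" "?q < length ?J0"
    using i a b pos_less[of b m i h] pos_less[of i h a n] by (auto simp: mult.commute length_I_seq length_J_seq)
  have P: "?P j < (m + h) * n" and Q: "?Q j < (n + h) * m" if "j \<le> ?N" for j
    using that pq by (auto simp: A B pos_left_def pos_right_def length_I_seq)
  have inj: "?P j \<noteq> ?P j'" "?Q j \<noteq> ?Q j'" if "j < j'" "j' \<le> ?N" for j j'
    using that pq by (auto simp: pos_left_def pos_right_def length_I_seq)
  have "bi_young n ((m + h) * n) ((n + h) * m) (tab_s n m h) (tab_t n m h) (linked_theta (n + m) n ?N ?I0 ?J0 ?p ?q) I K = (0::'a)"
  proof (rule bi_young_eq_0_swap[OF IK])
    fix \<tau> \<sigma> assume \<tau>: "\<tau> \<in> col_stab ((m + h) * n) (tab_s n m h)" and \<sigma>: "\<sigma> \<in> row_stab ((n + h) * m) (tab_t n m h)"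
    let ?f = "\<lambda>j. (fst (tab_s n m h (\<tau> (?P j))), snd (tab_t n m h (\<sigma> (?Q j))))"
    have "?f ` {..?N} \<subseteq> {..<n} \<times> {..<m}"
    proof (clarsimp, intro conjI)
      fix j assume j: "j \<le> ?N"
      show "fst (tab_s n m h (\<tau> (?P j))) < n" using a by (simp add: fst_tab_s_less)
      have "\<sigma> (?Q j) < (n + h) * m"
        using Q[OF j] stab_permutes(1)[OF \<sigma>] by (simp only: permutes_lessThan_less)
      then show "snd (tab_t n m h (\<sigma> (?Q j))) < m" by (rule snd_tab_t_less)
    qed
    then have "card (?f ` {..?N}) \<le> card ({..<n} \<times> {..<m})" by (intro card_mono) auto
    then have "\<not> inj_on ?f {..?N}" by (intro pigeonhole) simp
    \<comment> \<open>The pairs are put in order because \<open>linked_theta_swap\<close> admits the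
      additional pair only as the second one.\<close>
    then have "\<not> (\<forall>j1 j2. j1 < j2 \<longrightarrow> j2 \<le> ?N \<longrightarrow> ?f j1 \<noteq> ?f j2)"
      by (intro notI, elim notE, intro linorder_inj_onI) auto
    then obtain j1 j2 where j: "j1 < j2" "j2 \<le> ?N" "?f j1 = ?f j2"
      by blast
    have "bi_act n (transpose (?P j1) (?P j2)) (transpose (?Q j1) (?Q j2)) (linked_theta (n + m) n ?N ?I0 ?J0 ?p ?q) I K
        = (linked_theta (n + m) n ?N ?I0 ?J0 ?p ?q I K :: 'a)"
      if "I \<in> seqs (n + m) ((m + h) * n)" "K \<in> seqs (n + m) ((n + h) * m)" for I K
      using linked_theta_swap[OF set_I_seq set_J_seq that[unfolded A B] pq j(1,2), where 'a = 'a]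
      by (simp add: length_I_seq)
    then show "\<exists>p q p' q'. p < (m + h) * n \<and> q < (m + h) * n \<and> p' < (n + h) * m \<and> q' < (n + h) * m \<and> p \<noteq> q \<and> p' \<noteq> q' \<and>
         fst (tab_s n m h (\<tau> p)) = fst (tab_s n m h (\<tau> q)) \<and> snd (tab_t n m h (\<sigma> p')) = snd (tab_t n m h (\<sigma> q')) \<and>
         (\<forall>I\<in>seqs (n + m) ((m + h) * n). \<forall>K\<in>seqs (n + m) ((n + h) * m).
            bi_act n (transpose p q) (transpose p' q') (linked_theta (n + m) n ?N ?I0 ?J0 ?p ?q) I K = (linked_theta (n + m) n ?N ?I0 ?J0 ?p ?q I K :: 'a))"
      using j P[of j1] P[of j2] Q[of j1] Q[of j2] inj[OF j(1,2)]
      by (intro exI[of _ "?P j1"] exI[of _ "?P j2"] exI[of _ "?Q j1"] exI[of _ "?Q j2"]) auto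
  qed
  then show ?thesis
    unfolding linked_theta_def sym_theta_def by (simp only: bi_young_sum)
qed

text \<open>In the linked sum any \<open>l\<close> other than \<open>a\<close> and
  \<open>n + b\<close> repeats an even letter in a column or an odd letter in a row and vanishes.
  \<open>l = a\<close> leaves \<open>I_h\<close> as it is, \<open>l = n + b\<close> leaves
  \<open>J_h\<close> as it is, and the weights 1 and (-1)^(1 + q) of these two, with q =
  \<open>b * h + i\<close>, give the sign.\<close>

lemma sym_theta_odd:
  assumes IK: "I \<in> seqs (n + m) ((m + h) * n)" "K \<in> seqs (n + m) ((n + h) * m)"
    and i: "i < h" and a: "a < n" and b: "b < m"
  shows "sym_theta n m h ((I_seq n h)[i * n + a := n + b]) (J_seq n m h) I K =
     (- 1) ^ (b * h + i) * (sym_theta n m h (I_seq n h) ((J_seq n m h)[b * h + i := a]) I K :: 'a::field_char_0)"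
proof -
  let ?I0 = "I_seq n h" and ?J0 = "J_seq n m h" and ?p = "i * n + a" and ?q = "b * h + i"
  let ?g = "\<lambda>l. (- 1) ^ (par n l * (1 + ?q)) * (sym_theta n m h (?I0[?p := l]) (?J0[?q := l]) I K :: 'a)"
  have pq: "?p < h * n" "?q < h * m"
    using i a b pos_less[of b m i h] pos_less[of i h a n] by (auto simp: mult.commute)
  have Ia: "?I0[?p := a] = ?I0" using a pq nth_I_seq[OF pq(1)] by (metis list_update_id mod_mult_self3 mod_less)
  have "?J0 ! ?q = n + b" using nth_J_seq[OF pq(2), of n] i by simp
  then have Jb: "?J0[?q := n + b] = ?J0" by (metis list_update_id)
  have "?g l = 0" if l: "l < n + m" "l \<noteq> a" "l \<noteq> n + b" for l
  proof (cases "l < n")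
    case True
    then show ?thesis using sym_theta_eq_0_col[OF IK i a True l(2), where 'a = 'a] by simp
  next
    case False
    then have "l = n + (l - n)" "l - n < m" "l - n \<noteq> b" using l by auto
    then show ?thesis using sym_theta_eq_0_row[OF IK i b, of "l - n", where 'a = 'a] by simp
  qed
  then have "(\<Sum>l<n + m. ?g l) = (\<Sum>l\<in>{a, n + b}. ?g l)"
    using a b by (intro sum.mono_neutral_right) auto
  then have "?g a + ?g (n + b) = 0"
    using sym_theta_linked_theta[OF IK i a b, where 'a = 'a] a by simp
  then have "sym_theta n m h ?I0 (?J0[?q := a]) I K - (- 1) ^ ?q * sym_theta n m h (?I0[?p := n + b]) ?J0 I K = (0::'a)"
    using a by (simp add: Ia Jb par_def)
  then have "(- 1) ^ ?q * sym_theta n m h ?I0 (?J0[?q := a]) I K = ((- 1) ^ ?q * (- 1) ^ ?q) * (sym_theta n m h (?I0[?p := n + b]) ?J0 I K :: 'a)"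
    by simp
  also have "(- 1) ^ ?q * (- 1) ^ ?q = (1 :: 'a)"
    unfolding power_add[symmetric] by (rule neg_one_even_power) simp
  finally show ?thesis by simp
qed

section \<open>The action of an elementary matrix on the element\<close>

lemma bi_act_add: "bi_act n \<sigma> \<sigma>' (\<lambda>I K. F I K + G I K) = (\<lambda>I K. bi_act n \<sigma> \<sigma>' F I K + bi_act n \<sigma> \<sigma>' G I K)"
  by (simp add: bi_act_def distrib_left)

lemma bi_young_add: "bi_young n A B s t (\<lambda>I K. F I K + G I K) I K = bi_young n A B s t F I K + bi_young n A B s t G I K"
  unfolding bi_young_def sum.distrib[symmetric]
  by (intro sum.cong) (auto simp: bi_act_add distrib_left)

text \<open>\<open>the_element\<close> and its symmetrized form are known to agree only on sequences
  of the right length and alphabet; replacing a letter stays among these.\<close>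

lemma actE_cong:
  assumes "I \<in> seqs d A" "K \<in> seqs d B" "a < d" "b < d"
    and FG: "\<And>I K. I \<in> seqs d A \<Longrightarrow> K \<in> seqs d B \<Longrightarrow> F I K = G I K"
  shows "actE n a b F I K = actE n a b G I K"
proof -
  have "I[k := a] \<in> seqs d A" "K[k := b] \<in> seqs d B" for k
    using assms set_update_subset_insert[of I k a] set_update_subset_insert[of K k b]
    by (auto simp: seqs_def)
  then show ?thesis using assms(1,2) by (simp add: actE_def Let_def FG cong: if_cong)
qed

text \<open>An even letter occurs \<open>h\<close> times in \<open>I_h\<close>, where the dual
  action gives -1 each time; an odd letter occurs \<open>h\<close> times in \<open>J_h\<close> and
  gives 1 each time. The common formula -h(-1)^p(a) is the source of the supertrace. For
  \<open>a\<close> odd and \<open>b\<close> even there is no letter to replace.\<close>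

lemma actE_the_element:
  assumes IK: "I \<in> seqs (n + m) ((m + h) * n)" "K \<in> seqs (n + m) ((n + h) * m)"
    and ab: "a < n + m" "b < n + m"
  shows "actE n a b (the_element n m h) I K =
     (if a = b then - of_nat h * (- 1) ^ par n a * the_element n m h I K else (0::'a::field_char_0))"
proof -
  let ?I0 = "I_seq n h" and ?J0 = "J_seq n m h"
  let ?N = "n * m"
  let ?Y = "bi_young n ((m + h) * n) ((n + h) * m) (tab_s n m h) (tab_t n m h) :: (_ \<Rightarrow> _ \<Rightarrow> 'a) \<Rightarrow> _"
  let ?S1 = "\<lambda>I K. \<Sum>k<h * n. (if ?I0 ! k = a then - 1 else 0) * (dressed_theta n ?N (?I0[k := b]) ?J0 I K :: 'a)"
  let ?S2 = "\<lambda>I K. \<Sum>k<h * m. (if ?J0 ! k = b then (- 1) ^ ((par n a + 1) * k) else 0) * (dressed_theta n ?N ?I0 (?J0[k := a]) I K :: 'a)"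
  have W: "the_element n m h I K = (sym_theta n m h ?I0 ?J0 I K :: 'a)"
    by (rule the_element_eq[OF IK])
  have "actE n a b (the_element n m h) I K = actE n a b (?Y (dressed_theta n ?N ?I0 ?J0)) I K"
    by (rule actE_cong[OF IK ab]) (simp add: the_element_eq sym_theta_def)
  also have "\<dots> = ?Y (actE n a b (dressed_theta n ?N ?I0 ?J0)) I K"
    by (rule actE_bi_young[OF IK ab])
  also have "\<dots> = ?Y (\<lambda>I K. ?S1 I K + ?S2 I K) I K"
  proof (rule bi_young_cong[OF IK])
    fix I K assume "I \<in> seqs (n + m) ((m + h) * n)" "K \<in> seqs (n + m) ((n + h) * m)"
    then have len: "length I = length ?I0 + ?N" "length K = ?N + length ?J0"
      by (auto simp: seqs_def length_I_seq length_J_seq algebra_simps)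
    show "actE n a b (dressed_theta n ?N ?I0 ?J0) I K = ?S1 I K + ?S2 I K"
    proof (subst actE_dressed_theta[OF _ _ len])
      show "- (\<Sum>k<length ?I0. if ?I0 ! k = a then dressed_theta n ?N (?I0[k := b]) ?J0 I K else 0)
          + (\<Sum>k<length ?J0. if ?J0 ! k = b then (- 1) ^ ((par n a + 1) * k) * dressed_theta n ?N ?I0 (?J0[k := a]) I K else 0)
          = ?S1 I K + ?S2 I K"
        unfolding length_I_seq length_J_seq sum_negf[symmetric]
        by (intro arg_cong2[where f = "(+)"] sum.cong) auto
    qed (auto dest: set_I_seq set_J_seq)
  qed
  also have "\<dots> = (\<Sum>k<h * n. (if ?I0 ! k = a then - 1 else 0) * sym_theta n m h (?I0[k := b]) ?J0 I K)
     + (\<Sum>k<h * m. (if ?J0 ! k = b then (- 1) ^ ((par n a + 1) * k) else 0) * sym_theta n m h ?I0 (?J0[k := a]) I K)"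
    by (simp only: bi_young_add bi_young_sum sym_theta_def)
  also have "\<dots> = (\<Sum>k<h * n. if ?I0 ! k = a then - sym_theta n m h (?I0[k := b]) ?J0 I K else 0)
     + (\<Sum>k<h * m. if ?J0 ! k = b then (- 1) ^ ((par n a + 1) * k) * sym_theta n m h ?I0 (?J0[k := a]) I K else 0)"
    by (intro arg_cong2[where f = "(+)"] sum.cong) auto
  finally have act: "actE n a b (the_element n m h) I K =
      (\<Sum>k<h * n. if ?I0 ! k = a then - sym_theta n m h (?I0[k := b]) ?J0 I K else 0)
     + (\<Sum>k<h * m. if ?J0 ! k = b then (- 1) ^ ((par n a + 1) * k) * (sym_theta n m h ?I0 (?J0[k := a]) I K :: 'a) else 0)"
    (is "_ = ?T1 + ?T2") .
  have T1: "?T1 = (\<Sum>i<h. - sym_theta n m h (?I0[i * n + a := b]) ?J0 I K)" if "a < n"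
    using that by (rule sum_I_seq)
  have T1_0: "?T1 = 0" if "\<not> a < n"
  proof (rule sum.neutral, rule ballI)
    fix k assume "k \<in> {..<h * n}"
    then have "?I0 ! k < n" by (intro set_I_seq[of _ n h]) (auto simp: length_I_seq)
    then show "(if ?I0 ! k = a then - sym_theta n m h (?I0[k := b]) ?J0 I K else 0) = (0::'a)" using that by auto
  qed
  have T2: "?T2 = (\<Sum>i<h. (- 1) ^ ((par n a + 1) * (b' * h + i)) * (sym_theta n m h ?I0 (?J0[b' * h + i := a]) I K :: 'a))"
    if "b' < m" "b = n + b'" for b'
    unfolding that(2) using that(1) by (rule sum_J_seq)
  have T2_0: "?T2 = 0" if "b < n"
  proof (rule sum.neutral, rule ballI)
    fix k assume "k \<in> {..<h * m}"
    then have "\<not> ?J0 ! k < n" by (intro set_J_seq[of _ n m h]) (auto simp: length_J_seq)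
    then show "(if ?J0 ! k = b then (- 1) ^ ((par n a + 1) * k) * sym_theta n m h ?I0 (?J0[k := a]) I K else 0) = (0::'a)"
      using that by auto
  qed
  show ?thesis
  proof (cases "a < n")
    case a: True
    show ?thesis
    proof (cases "b < n")
      case b: True
      have "sym_theta n m h (?I0[i * n + a := b]) ?J0 I K = (if a = b then sym_theta n m h ?I0 ?J0 I K else (0::'a))" if "i < h" for i
      proof (cases "a = b")
        case True
        have "?I0 ! (i * n + a) = a" using a nth_I_seq[OF pos_less[OF that a]] by simp
        then have "?I0[i * n + a := a] = ?I0" by (metis list_update_id)
        then show ?thesis using True by simp
      next
        case False
        then show ?thesis using sym_theta_eq_0_col[OF IK that a b, where 'a = 'a] by auto
      qed
      then show ?thesis
        unfolding act T1[OF a] T2_0[OF b] W using a by (simp add: par_def)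
    next
      case b: False
      define b' where "b' = b - n"
      have b': "b = n + b'" "b' < m" using b ab by (auto simp: b'_def)
      \<comment> \<open>As \<open>a\<close> is even, the weight in the second sum is precisely the
        sign of \<open>sym_theta_odd\<close>, so the two terms with the same \<open>i\<close>
        cancel.\<close>
      have "?T1 + ?T2 = (\<Sum>i<h. - sym_theta n m h (?I0[i * n + a := n + b']) ?J0 I K +
          (- 1) ^ (b' * h + i) * (sym_theta n m h ?I0 (?J0[b' * h + i := a]) I K :: 'a))"
        unfolding T1[OF a] T2[OF b'(2,1)] sum.distrib[symmetric] using a b' by (simp add: par_def)
      also have "\<dots> = 0"
        by (rule sum.neutral) (use sym_theta_odd[OF IK _ a b'(2), where 'a = 'a] in simp)
      finally show ?thesis unfolding act using a b by auto
    qed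
  next
    case a: False
    define a' where "a' = a - n"
    have a': "a = n + a'" "a' < m" using a ab by (auto simp: a'_def)
    show ?thesis
    proof (cases "b < n")
      case b: True
      then show ?thesis unfolding act T1_0[OF a] T2_0[OF b] using a by auto
    next
      case b: False
      define b' where "b' = b - n"
      have b': "b = n + b'" "b' < m" using b ab by (auto simp: b'_def)
      have "sym_theta n m h ?I0 (?J0[b' * h + i := a]) I K = (if a = b then sym_theta n m h ?I0 ?J0 I K else (0::'a))" if i: "i < h" for i
      proof (cases "a = b")
        case True
        have "?J0 ! (b' * h + i) = a"
          using True b' i nth_J_seq[of "b' * h + i" h m n] pos_less[OF b'(2) i] by (simp add: mult.commute)
        then have "?J0[b' * h + i := a] = ?J0" by (metis list_update_id)
        then show ?thesis using True by simp
      next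
        case False
        then show ?thesis using sym_theta_eq_0_row[OF IK i b'(2) a'(2), where 'a = 'a] a' b' by auto
      qed
      then have "?T2 = (\<Sum>i<h. if a = b then sym_theta n m h ?I0 ?J0 I K else (0::'a))"
        unfolding T2[OF b'(2,1)] using a by (intro sum.cong) (auto simp: par_def)
      then show ?thesis
        unfolding act T1_0[OF a] W using a by (simp add: par_def)
    qed
  qed
qed

theorem theorem3p3:
  fixes n m h :: nat
  shows "sl_invariant n m ((m + h) * n) ((n + h) * m)
           (the_element n m h :: nat list \<Rightarrow> nat list \<Rightarrow> 'a::field_char_0)"
  unfolding sl_invariant_def
proof (intro allI impI ballI)
  fix x :: "nat \<Rightarrow> nat \<Rightarrow> 'a" and I K
  assume str: "supertrace n m x = 0"
    and IK: "I \<in> seqs (n + m) ((m + h) * n)" "K \<in> seqs (n + m) ((n + h) * m)"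
  let ?W = "the_element n m h I K :: 'a"
  have "act_gl n m x (the_element n m h) I K =
      (\<Sum>a<n + m. \<Sum>b<n + m. if a = b then x a b * (- of_nat h * (- 1) ^ par n a * ?W) else 0)"
    unfolding act_gl_def by (intro sum.cong refl) (use actE_the_element[OF IK, where 'a = 'a] in auto)
  also have "\<dots> = (\<Sum>a<n + m. x a a * (- of_nat h * (- 1) ^ par n a * ?W))"
    by (intro sum.cong refl) auto
  also have "\<dots> = - of_nat h * ?W * supertrace n m x"
    unfolding supertrace_def sum_distrib_left by (intro sum.cong refl) (simp add: mult_ac)
  finally show "act_gl n m x (the_element n m h) I K = 0"
    using str by simp
qed

end
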